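(* Assume $\mathrm{add}(\mathcal M)=\mathfrak c$ (e.g. assume CH). Then there exist two $\mathrm{add}(\mathcal M)$-Luzin sets $L_0,L_1\subseteq[\mathbb N]^\infty$, each satisfying $\mathsf S_1(B_\Omega,B_\Omega)$ (and therefore each satisfying $\mathrm{Split}(B_\Omega,B_\Omega)$ and $\mathrm{Split}(B_\Lambda,B_\Lambda)$), such that $L_0\cup L_1$ satisfies $\mathrm{Split}(B_\Lambda,B_\Lambda)$ but does not satisfy $\mathrm{Split}(C_\Omega,C_\Omega)$.
   Context: $[\mathbb N]^\infty$ is the set of infinite subsets of $\mathbb N$, a subspace of $P(\mathbb N)\cong\{0,1\}^{\mathbb N}$. $\mathcal M$ is the ideal of meager sets; $\mathrm{add}(\mathcal M)$ is the least cardinality of a family of meager sets whose union is not meager; $\mathfrak c=2^{\aleph_0}$. For an uncountable cardinal $\kappa$, a $\kappa$-Luzin set is a set $L$ with $|L|\ge\kappa$ such that $|L\cap M|<\kappa$ for every meager $M$. A cover of a space $X$ is a family $\mathcal U$ of subsets of $X$ with $\bigcup\mathcal U=X$ such that $X\not\subseteq U$ for all $U\in\mathcal U$; it is a large cover if every $x\in X$ lies in infinitely many members, an $\omega$-cover if every finite subset of $X$ is contained in some member. $B_\Lambda,B_\Omega$ are the collections of countable Borel large covers and countable Borel $\omega$-covers of $X$; $C_\Omega$ the collection of countable clopen $\omega$-covers. $X$ satisfies $\mathrm{Split}(\mathfrak U,\mathfrak V)$ if every $\mathcal U\in\mathfrak U$ can be partitioned into two disjoint subfamilies each containing a subfamily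 belonging to $\mathfrak V$. $X$ satisfies $\mathsf S_1(\mathfrak U,\mathfrak V)$ if for every sequence $(\mathcal U_n)_{n\in\mathbb N}$ of members of $\mathfrak U$ there are $U_n\in\mathcal U_n$ ($n\in\mathbb N$) such that $\{U_n:n\in\mathbb N\}\in\mathfrak V$. *)

theory Defs
  imports "HOL-Analysis.Analysis"
begin

text \<open>P(N) is identified with the Cantor space {0,1}^N (product of discrete
  two-point spaces) via characteristic functions.\<close>

definition chi :: "nat set \<Rightarrow> (nat \<Rightarrow> bool)" where
  "chi A = (\<lambda>n. n \<in> A)"

definition cantor_open :: "nat set set \<Rightarrow> bool" where
  "cantor_open U \<longleftrightarrow> open (chi ` U)"

definition cantor_closed :: "nat set set \<Rightarrow> bool" where
  "cantor_closed U \<longleftrightarrow> closed (chi ` U)"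

definition nowhere_dense :: "nat set set \<Rightarrow> bool" where
  "nowhere_dense N \<longleftrightarrow> interior (closure (chi ` N)) = {}"

definition meager :: "nat set set \<Rightarrow> bool" where
  "meager M \<longleftrightarrow> (\<exists>\<F>. countable \<F> \<and> (\<forall>N\<in>\<F>. nowhere_dense N) \<and> M \<subseteq> \<Union>\<F>)"

definition cantor_borel :: "nat set set \<Rightarrow> bool" where
  "cantor_borel B \<longleftrightarrow> chi ` B \<in> sets borel"

definition inf_subsets :: "nat set set" where
  "inf_subsets = {A. infinite A}"

definition add_M_is :: "'k set \<Rightarrow> bool" where
  "add_M_is K \<longleftrightarrow>
     (\<exists>F :: nat set set set. (\<forall>M\<in>F. meager M) \<and> \<not> meager (\<Union>F) \<and> ((card_of F, card_of K) \<in> ordIso)) \<and>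
     (\<forall>F :: nat set set set. (\<forall>M\<in>F. meager M) \<and> ((card_of F, card_of K) \<in> ordLess) \<longrightarrow> meager (\<Union>F))"

definition luzin :: "'k set \<Rightarrow> nat set set \<Rightarrow> bool" where
  "luzin K L \<longleftrightarrow> ((card_of K, card_of L) \<in> ordLeq) \<and>
     (\<forall>M. meager M \<longrightarrow> ((card_of (L \<inter> M), card_of K) \<in> ordLess))"

definition borel_in :: "nat set set \<Rightarrow> nat set set \<Rightarrow> bool" where
  "borel_in X U \<longleftrightarrow> (\<exists>B. cantor_borel B \<and> U = X \<inter> B)"

definition clopen_in :: "nat set set \<Rightarrow> nat set set \<Rightarrow> bool" where
  "clopen_in X U \<longleftrightarrow> (\<exists>G. cantor_open G \<and> U = X \<inter> G) \<and> (\<exists>C. cantor_closed C \<and> U = X \<inter> C)"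

definition is_cover :: "'a set \<Rightarrow> 'a set set \<Rightarrow> bool" where
  "is_cover X \<U> \<longleftrightarrow> \<Union>\<U> = X \<and> (\<forall>U\<in>\<U>. \<not> X \<subseteq> U)"

definition large_cover :: "'a set \<Rightarrow> 'a set set \<Rightarrow> bool" where
  "large_cover X \<U> \<longleftrightarrow> is_cover X \<U> \<and> (\<forall>x\<in>X. infinite {U\<in>\<U>. x \<in> U})"

definition omega_cover :: "'a set \<Rightarrow> 'a set set \<Rightarrow> bool" where
  "omega_cover X \<U> \<longleftrightarrow> is_cover X \<U> \<and> (\<forall>F. finite F \<and> F \<subseteq> X \<longrightarrow> (\<exists>U\<in>\<U>. F \<subseteq> U))"

definition B_Lambda :: "nat set set \<Rightarrow> nat set set set set" where
  "B_Lambda X = {\<U>. countable \<U> \<and> (\<forall>U\<in>\<U>. borel_in X U) \<and> large_cover X \<U>}"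

definition B_Omega :: "nat set set \<Rightarrow> nat set set set set" where
  "B_Omega X = {\<U>. countable \<U> \<and> (\<forall>U\<in>\<U>. borel_in X U) \<and> omega_cover X \<U>}"

definition C_Omega :: "nat set set \<Rightarrow> nat set set set set" where
  "C_Omega X = {\<U>. countable \<U> \<and> (\<forall>U\<in>\<U>. clopen_in X U) \<and> omega_cover X \<U>}"

definition Split :: "'a set set set \<Rightarrow> 'a set set set \<Rightarrow> bool" where
  "Split \<AA> \<BB> \<longleftrightarrow> (\<forall>\<U>\<in>\<AA>. \<exists>\<V> \<W>. \<V> \<union> \<W> = \<U> \<and> \<V> \<inter> \<W> = {} \<and>
      (\<exists>\<V>'\<subseteq>\<V>. \<V>' \<in> \<BB>) \<and> (\<exists>\<W>'\<subseteq>\<W>. \<W>' \<in> \<BB>))"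

definition S1 :: "'a set set set \<Rightarrow> 'a set set set \<Rightarrow> bool" where
  "S1 \<AA> \<BB> \<longleftrightarrow> (\<forall>\<U> :: nat \<Rightarrow> 'a set set. (\<forall>n. \<U> n \<in> \<AA>) \<longrightarrow>
      (\<exists>U :: nat \<Rightarrow> 'a set. (\<forall>n. U n \<in> \<U> n) \<and> range U \<in> \<BB>))"

end

theory Submission
  imports Defs
begin

text \<open>Along a well-order of length continuum choose a generic set \<open>x\<^sub>a\<close> and put
  \<open>z\<^sub>a = x\<^sub>a \<triangle> (- A)\<close>, where \<open>A\<close> is whichever of \<open>a\<close> and \<open>- a\<close> is compatible with the filter built
  so far. Translation is a homeomorphism, so \<open>z\<^sub>a\<close> is generic as well, while
  \<open>x\<^sub>a \<inter> z\<^sub>a = x\<^sub>a \<inter> A\<close> decides \<open>a\<close>: the two generic sequences are Luzin sets whose union is a subbase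
  of a nonprincipal ultrafilter, and the cover by the sets \<open>{x. n \<in> x}\<close> cannot be split.

  For the selection principle of each sequence, call a sequence of Borel sets omega-fat for \<open>X\<close> if
  every finite subset of \<open>X\<close> is contained in a member that is in addition nonmeager in finitely many
  prescribed basic open sets. Countable Borel omega-covers of a nowhere meager set are omega-fat,
  fewer than continuum many points allow an omega-fat selection, and omega-fatness survives the
  addition of a generic point. Hence a selection made at the stage at which a sequence of covers is
  enumerated still works for the whole set.

  Splitting follows from selections: select from the covers by intersections of \<open>2n + 2\<close> distinct
  members, and pick greedily two unused members of each selected tuple.\<close>

unbundle cardinal_syntax

subsection \<open>Category in the Cantor space\<close>

definition cyl :: "nat \<Rightarrow> nat set \<Rightarrow> nat set set" where
  "cyl n s = {A. A \<inter> {..<n} = s \<inter> {..<n}}"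

lemma mem_cyl: "A \<in> cyl n s \<longleftrightarrow> (\<forall>i<n. i \<in> A \<longleftrightarrow> i \<in> s)"
  unfolding cyl_def by blast

lemma self_mem_cyl [simp]: "s \<in> cyl n s"
  by (simp add: mem_cyl)

lemma cyl_mono: "n \<le> m \<Longrightarrow> t \<in> cyl n s \<Longrightarrow> cyl m t \<subseteq> cyl n s"
  by (auto simp: mem_cyl)

lemma inj_chi: "inj chi"
  by (auto simp: inj_on_def chi_def fun_eq_iff)

lemma surj_chi [simp]: "surj chi"
  unfolding surj_def chi_def by (metis (full_types) Collect_mem_eq mem_Collect_eq)

lemma bij_chi: "bij chi"
  by (simp add: bij_def inj_chi surj_chi)

lemma chi_image_vimage: "chi ` (chi -` S) = S"
  by (simp add: surj_chi surj_image_vimage_eq)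

lemma chi_vimage_image: "chi -` (chi ` S) = S"
  by (simp add: inj_chi inj_vimage_image_eq)

lemma open_cyl: "open (chi ` cyl n s)"
proof -
  have "chi ` cyl n s = Pi\<^sub>E UNIV (\<lambda>i. if i < n then {i \<in> s} else UNIV)"
  proof (intro subset_antisym subsetI)
    fix f assume "f \<in> Pi\<^sub>E UNIV (\<lambda>i. if i < n then {i \<in> s} else UNIV)"
    then have "Collect f \<in> cyl n s"
      by (auto simp: mem_cyl PiE_def Pi_def split: if_splits)
    moreover have "chi (Collect f) = f"
      by (simp add: chi_def)
    ultimately show "f \<in> chi ` cyl n s"
      by (metis imageI)
  qed (auto simp: mem_cyl chi_def)
  moreover have "finite {i. (if i < n then {i \<in> s} else UNIV) \<noteq> (UNIV :: bool set)}"
    by (rule finite_subset[of _ "{..<n}"]) auto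
  ultimately show ?thesis
    using open_PiE[of "\<lambda>i. if i < n then {i \<in> s} else UNIV"] by (simp add: open_discrete)
qed

text \<open>A basic open box of the product topology restricts only finitely many coordinates; a
  bound \<open>n\<close> on these turns the box into a cylinder.\<close>

lemma cantor_open_iff: "cantor_open U \<longleftrightarrow> (\<forall>A\<in>U. \<exists>n. cyl n A \<subseteq> U)"
proof
  assume U: "cantor_open U"
  show "\<forall>A\<in>U. \<exists>n. cyl n A \<subseteq> U"
  proof
    fix A assume "A \<in> U"
    then have "openin (product_topology (\<lambda>i. euclidean) UNIV) (chi ` U)" "chi A \<in> chi ` U"
      using U by (auto simp: cantor_open_def open_fun_def)
    from product_topology_open_contains_basis[OF this]
    obtain X where X: "chi A \<in> Pi\<^sub>E UNIV X" "finite {i. X i \<noteq> UNIV}" "Pi\<^sub>E UNIV X \<subseteq> chi ` U"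
      by auto
    obtain n where n: "{i. X i \<noteq> UNIV} \<subseteq> {..<n}"
      using X(2) finite_nat_bounded by blast
    have "cyl n A \<subseteq> U"
    proof
      fix B assume B: "B \<in> cyl n A"
      have "chi B i \<in> X i" for i
      proof (cases "i < n")
        case True
        then have "chi B i = chi A i"
          using B by (simp add: chi_def mem_cyl)
        then show ?thesis
          using X(1) by (auto simp: PiE_def Pi_def)
      qed (use n in auto)
      then have "chi B \<in> chi ` U"
        using X(3) by auto
      then show "B \<in> U"
        using inj_chi by (simp add: inj_image_mem_iff)
    qed
    then show "\<exists>n. cyl n A \<subseteq> U" ..
  qed
next
  assume *: "\<forall>A\<in>U. \<exists>n. cyl n A \<subseteq> U"
  show "cantor_open U"
    unfolding cantor_open_def
  proof (rule Topological_Spaces.openI)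
    fix f assume "f \<in> chi ` U"
    then obtain A where A: "A \<in> U" "f = chi A" by blast
    then obtain n where "cyl n A \<subseteq> U" using * by blast
    then show "\<exists>T. open T \<and> f \<in> T \<and> T \<subseteq> chi ` U"
      using open_cyl[of n A] A by (intro exI[of _ "chi ` cyl n A"]) auto
  qed
qed

lemma cantor_open_cyl: "cantor_open (cyl n s)"
  by (simp add: cantor_open_def open_cyl)

lemma cantor_open_Union: "(\<And>U. U \<in> \<U> \<Longrightarrow> cantor_open U) \<Longrightarrow> cantor_open (\<Union>\<U>)"
  unfolding cantor_open_def by (auto simp: image_Union)

lemma cantor_open_Un: "cantor_open U \<Longrightarrow> cantor_open V \<Longrightarrow> cantor_open (U \<union> V)"
  unfolding cantor_open_def by (simp add: image_Un open_Un)

text \<open>A cylinder is open, so it misses \<open>N\<close> iff it misses the closure of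
  \<open>N\<close>. This reduces density arguments to extending cylinders.\<close>

lemma nowhere_dense_iff:
  "nowhere_dense N \<longleftrightarrow> (\<forall>n s. \<exists>m t. cyl m t \<subseteq> cyl n s \<and> cyl m t \<inter> N = {})"
proof
  assume N: "nowhere_dense N"
  show "\<forall>n s. \<exists>m t. cyl m t \<subseteq> cyl n s \<and> cyl m t \<inter> N = {}"
  proof (intro allI)
    fix n s
    have "\<not> chi ` cyl n s \<subseteq> closure (chi ` N)"
      using N interior_maximal[OF _ open_cyl[of n s]] imageI[OF self_mem_cyl[of s n], of chi]
      unfolding nowhere_dense_def by blast
    then obtain A where A: "A \<in> cyl n s" "chi A \<notin> closure (chi ` N)" by blast
    define U where "U = chi -` (chi ` cyl n s - closure (chi ` N))"
    have "cantor_open U"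
      by (simp add: U_def cantor_open_def chi_image_vimage open_Diff open_cyl)
    moreover have "A \<in> U"
      using A by (simp add: U_def)
    ultimately obtain m where "cyl m A \<subseteq> U"
      by (meson cantor_open_iff)
    moreover have "U \<subseteq> cyl n s"
      unfolding U_def vimage_Diff chi_vimage_image by blast
    moreover have "U \<inter> N = {}"
      unfolding U_def using closure_subset[of "chi ` N"] by blast
    ultimately show "\<exists>m t. cyl m t \<subseteq> cyl n s \<and> cyl m t \<inter> N = {}"
      by blast
  qed
next
  assume *: "\<forall>n s. \<exists>m t. cyl m t \<subseteq> cyl n s \<and> cyl m t \<inter> N = {}"
  have False if "f \<in> interior (closure (chi ` N))" for f
  proof -
    define G where "G = chi -` interior (closure (chi ` N))"
    have "cantor_open G"
      unfolding G_def cantor_open_def chi_image_vimage by (rule open_interior)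
    moreover obtain A where A: "f = chi A"
      using surjD[OF surj_chi, of f] by (elim exE)
    have "A \<in> G"
      using that by (simp add: G_def A)
    ultimately obtain n where n: "cyl n A \<subseteq> G"
      by (meson cantor_open_iff)
    obtain m t where "cyl m t \<subseteq> cyl n A" and t: "cyl m t \<inter> N = {}"
      using * by blast
    with n have tG: "t \<in> G"
      using self_mem_cyl[of t m] by blast
    have "chi ` cyl m t \<inter> chi ` N = {}"
      using image_Int[OF inj_chi, of "cyl m t" N] t by simp
    then have "chi ` cyl m t \<inter> closure (chi ` N) = {}"
      by (simp add: open_Int_closure_eq_empty open_cyl)
    moreover have "chi t \<in> closure (chi ` N)"
      using tG interior_subset[of "closure (chi ` N)"] unfolding G_def by blast
    ultimately show False
      using imageI[OF self_mem_cyl[of t m], of chi] by blast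
  qed
  then show "nowhere_dense N"
    unfolding nowhere_dense_def by blast
qed

lemma meager_subset: "meager M \<Longrightarrow> N \<subseteq> M \<Longrightarrow> meager N"
  unfolding meager_def by (meson subset_trans)

lemma nowhere_dense_imp_meager: "nowhere_dense N \<Longrightarrow> meager N"
  unfolding meager_def by (intro exI[of _ "{N}"]) auto

lemma meager_empty: "meager {}"
  unfolding meager_def by (intro exI[of _ "{}"]) auto

lemma meager_UN_countable:
  assumes "countable I" "\<And>i. i \<in> I \<Longrightarrow> meager (M i)"
  shows "meager (\<Union>i\<in>I. M i)"
proof -
  obtain F where F: "\<And>i. i \<in> I \<Longrightarrow> countable (F i) \<and> (\<forall>N\<in>F i. nowhere_dense N) \<and> M i \<subseteq> \<Union>(F i)"
    using assms(2) unfolding meager_def by metis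
  then show ?thesis
    unfolding meager_def using assms(1)
    by (intro exI[of _ "\<Union>i\<in>I. F i"]) (auto, blast)
qed

lemma meager_Un: "meager M \<Longrightarrow> meager N \<Longrightarrow> meager (M \<union> N)"
  using meager_UN_countable[of "{M, N}" id] by auto

lemma meager_iff_seq: "meager M \<longleftrightarrow> (\<exists>N::nat \<Rightarrow> _. (\<forall>i. nowhere_dense (N i)) \<and> M \<subseteq> (\<Union>i. N i))"
proof
  assume "meager M"
  then obtain F where F: "countable F" "\<forall>N\<in>F. nowhere_dense N" "M \<subseteq> \<Union>F"
    unfolding meager_def by blast
  have nd: "nowhere_dense {}"
    unfolding nowhere_dense_iff by blast
  show "\<exists>N::nat \<Rightarrow> _. (\<forall>i. nowhere_dense (N i)) \<and> M \<subseteq> (\<Union>i. N i)"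
  proof (cases "F = {}")
    case True
    then show ?thesis using F nd by (intro exI[of _ "\<lambda>_. {}"]) auto
  next
    case False
    then show ?thesis
      using F(2,3) range_from_nat_into[OF False F(1)] from_nat_into[OF False]
      by (intro exI[of _ "from_nat_into F"]) simp
  qed
next
  assume "\<exists>N::nat \<Rightarrow> _. (\<forall>i. nowhere_dense (N i)) \<and> M \<subseteq> (\<Union>i. N i)"
  then obtain N :: "nat \<Rightarrow> _" where "\<forall>i. nowhere_dense (N i)" "M \<subseteq> (\<Union>i. N i)"
    by blast
  then show "meager M"
    unfolding meager_def by (intro exI[of _ "range N"]) auto
qed

text \<open>The Baire category argument: nested cylinders \<open>C i\<close> avoid the sets
  \<open>N i\<close> one after another, and a common point of them contradicts the cover.\<close>

lemma Baire_cyl: "\<not> meager (cyl n s)"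
proof
  assume "meager (cyl n s)"
  then obtain N :: "nat \<Rightarrow> nat set set" where N: "\<And>i. nowhere_dense (N i)" "cyl n s \<subseteq> (\<Union>i. N i)"
    unfolding meager_iff_seq by blast
  obtain h where h: "\<And>i n s. cyl (fst (h i n s)) (snd (h i n s)) \<subseteq> cyl n s
      \<and> cyl (fst (h i n s)) (snd (h i n s)) \<inter> N i = {}"
  proof -
    have "\<forall>i n s. \<exists>p. cyl (fst p) (snd p) \<subseteq> cyl n s \<and> cyl (fst p) (snd p) \<inter> N i = {}"
      using N(1) unfolding nowhere_dense_iff by (metis fst_conv snd_conv)
    then show ?thesis
      using that by metis
  qed
  define c where "c = rec_nat (n, s) (\<lambda>i p. h i (fst p) (snd p))"
  define C where "C i = cyl (fst (c i)) (snd (c i))" for i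
  have c0: "C 0 = cyl n s" and cSuc: "C (Suc i) \<subseteq> C i" "C (Suc i) \<inter> N i = {}" for i
    using h by (simp_all add: c_def C_def)
  have mono: "C j \<subseteq> C i" if "i \<le> j" for i j
    by (rule lift_Suc_antimono_le[of C, OF cSuc(1) that])
  \<comment> \<open>The common point: coordinates that no stage decides are left out of
    \<open>A\<close>, and stages that decide a coordinate agree on it, so \<open>A\<close> lies in
    every \<open>C i\<close>.\<close>
  define A where "A = {k. \<exists>j. k < fst (c j) \<and> k \<in> snd (c j)}"
  have agree_le: "k \<in> snd (c j) \<longleftrightarrow> k \<in> snd (c i)" if "i \<le> j" "k < fst (c i)" for i j k
  proof -
    have "snd (c j) \<in> cyl (fst (c i)) (snd (c i))"
      using mono[OF that(1)] self_mem_cyl unfolding C_def by blast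
    then show ?thesis
      using that(2) by (simp add: mem_cyl)
  qed
  have agree: "k \<in> snd (c j) \<longleftrightarrow> k \<in> snd (c i)" if "k < fst (c i)" "k < fst (c j)" for i j k
    using agree_le[of i j k] agree_le[of j i k] that by (cases "i \<le> j") auto
  have A: "A \<in> C i" for i
    unfolding C_def mem_cyl
  proof (intro allI impI)
    fix k assume "k < fst (c i)"
    then show "k \<in> A \<longleftrightarrow> k \<in> snd (c i)"
      unfolding A_def mem_Collect_eq using agree by blast
  qed
  then have "A \<notin> N i" for i
    using cSuc(2)[of i] by blast
  then show False
    using N(2) A[of 0] c0 by auto
qed

lemma not_meager_UNIV: "\<not> meager UNIV"
  using Baire_cyl[of 0 "{}"] meager_subset by blast

lemma meager_avoid: "meager M \<Longrightarrow> \<exists>A. A \<notin> M"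
  using not_meager_UNIV UNIV_eq_I by metis

lemma meager_singleton: "meager {A}"
proof (rule nowhere_dense_imp_meager, unfold nowhere_dense_iff, intro allI)
  fix n s
  define t where "t = (if n \<in> A then s - {n} else insert n s)"
  have "cyl (Suc n) t \<subseteq> cyl n s" "cyl (Suc n) t \<inter> {A} = {}"
    by (auto simp: t_def mem_cyl)
  then show "\<exists>m t. cyl m t \<subseteq> cyl n s \<and> cyl m t \<inter> {A} = {}"
    by blast
qed

lemma nowhere_dense_compl_open_dense:
  assumes "cantor_open W" "\<And>n s. W \<inter> cyl n s \<noteq> {}"
  shows "nowhere_dense (- W)"
  unfolding nowhere_dense_iff
proof (intro allI)
  fix n s
  obtain A where A: "A \<in> W" "A \<in> cyl n s"
    using assms(2) by blast
  then obtain m where "cyl m A \<subseteq> W"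
    using assms(1) cantor_open_iff by blast
  then have "cyl (max n m) A \<subseteq> cyl n s" "cyl (max n m) A \<subseteq> W"
    using cyl_mono[of n "max n m" A s] cyl_mono[of m "max n m" A A] A by auto
  then show "\<exists>m t. cyl m t \<subseteq> cyl n s \<and> cyl m t \<inter> - W = {}"
    by blast
qed

text \<open>Symmetric difference with \<open>C\<close> is an involution that carries cylinders to
  cylinders of the same length. It transfers genericity between the two points of a stage.\<close>

lemma meager_translate:
  assumes "meager M"
  shows "meager {x. sym_diff x C \<in> M}"
proof -
  define \<tau> where "\<tau> x = sym_diff x C" for x
  have mem: "i \<in> \<tau> A \<longleftrightarrow> (i \<in> A) \<noteq> (i \<in> C)" for i A
    unfolding \<tau>_def by blast
  have tr: "\<tau> A \<in> cyl m t \<longleftrightarrow> A \<in> cyl m (\<tau> t)" for A m t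
    unfolding mem_cyl mem by blast
  obtain N :: "nat \<Rightarrow> nat set set" where N: "\<And>i. nowhere_dense (N i)" "M \<subseteq> (\<Union>i. N i)"
    using assms unfolding meager_iff_seq by blast
  have "nowhere_dense (\<tau> -` N i)" for i
    unfolding nowhere_dense_iff
  proof (intro allI)
    fix n s
    obtain m t where mt: "cyl m t \<subseteq> cyl n (\<tau> s)" "cyl m t \<inter> N i = {}"
      using N(1)[of i] unfolding nowhere_dense_iff by blast
    have "\<tau> (\<tau> s) = s"
      by (auto simp: mem)
    then have "cyl m (\<tau> t) \<subseteq> cyl n s"
      using mt(1) tr by (metis subset_iff)
    moreover have "cyl m (\<tau> t) \<inter> \<tau> -` N i = {}"
      using mt(2) tr by blast
    ultimately show "\<exists>m t. cyl m t \<subseteq> cyl n s \<and> cyl m t \<inter> \<tau> -` N i = {}"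
      by blast
  qed
  then have "meager (\<Union>i. \<tau> -` N i)"
    by (intro meager_UN_countable nowhere_dense_imp_meager) auto
  then have "meager (\<tau> -` M)"
    by (rule meager_subset) (use N(2) in blast)
  then show ?thesis
    unfolding \<tau>_def vimage_def .
qed

text \<open>A countable base indexed by natural numbers; finite stems suffice because a cylinder
  ignores its stem from its length on.\<close>

definition bas :: "nat \<Rightarrow> nat set set" where
  "bas k = cyl (fst (prod_decode k)) (set_decode (snd (prod_decode k)))"

lemma cyl_eq_bas: "\<exists>k. cyl n s = bas k"
proof
  have "finite (s \<inter> {..<n})" by simp
  then show "cyl n s = bas (prod_encode (n, set_encode (s \<inter> {..<n})))"
    by (simp add: bas_def cyl_def set_encode_inverse Int_assoc)
qed

lemma open_contains_bas: "cantor_open U \<Longrightarrow> A \<in> U \<Longrightarrow> \<exists>k. A \<in> bas k \<and> bas k \<subseteq> U"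
  unfolding cantor_open_iff by (metis cyl_eq_bas self_mem_cyl)

lemma cantor_open_bas: "cantor_open (bas k)"
  by (simp add: bas_def cantor_open_cyl)

lemma Baire_bas: "\<not> meager (bas k)"
  by (simp add: bas_def Baire_cyl)

section \<open>The property of Baire\<close>

definition Baire_property :: "nat set set \<Rightarrow> bool" where
  "Baire_property B \<longleftrightarrow> (\<exists>W. cantor_open W \<and> meager (sym_diff B W))"

lemma Baire_property_open: "cantor_open U \<Longrightarrow> Baire_property U"
  unfolding Baire_property_def by (intro exI[of _ U]) (simp add: meager_empty)

lemma Baire_property_Compl:
  assumes "Baire_property B"
  shows "Baire_property (- B)"
proof -
  obtain W where W: "cantor_open W" "meager (sym_diff B W)"
    using assms unfolding Baire_property_def by blast
  \<comment> \<open>\<open>V\<close> is the exterior of \<open>W\<close>; it differs from the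
    complement of \<open>W\<close> only by the nowhere dense boundary.\<close>
  define V where "V = \<Union>{bas k | k. bas k \<inter> W = {}}"
  have V: "cantor_open V"
    unfolding V_def by (rule cantor_open_Union) (auto simp: cantor_open_bas)
  have VW: "V \<inter> W = {}"
    unfolding V_def by blast
  have "(W \<union> V) \<inter> cyl n s \<noteq> {}" for n s
  proof (cases "cyl n s \<inter> W = {}")
    case True
    then have "s \<in> V"
      unfolding V_def using cyl_eq_bas[of n s] self_mem_cyl[of s n] by blast
    then show ?thesis
      using self_mem_cyl[of s n] by blast
  qed blast
  then have "nowhere_dense (- (W \<union> V))"
    using W(1) V by (intro nowhere_dense_compl_open_dense cantor_open_Un)
  then have "meager (- (W \<union> V) \<union> sym_diff B W)"
    using W(2) by (meson meager_Un nowhere_dense_imp_meager)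
  then have "meager (sym_diff (- B) V)"
    by (rule meager_subset) (use VW in blast)
  then show ?thesis
    unfolding Baire_property_def using V by blast
qed

lemma Baire_property_UN_countable:
  assumes "countable I" "\<And>i. i \<in> I \<Longrightarrow> Baire_property (B i)"
  shows "Baire_property (\<Union>i\<in>I. B i)"
proof -
  obtain W where W: "\<And>i. i \<in> I \<Longrightarrow> cantor_open (W i) \<and> meager (sym_diff (B i) (W i))"
    using assms(2) unfolding Baire_property_def by metis
  then have "meager (\<Union>i\<in>I. sym_diff (B i) (W i))"
    using assms(1) by (intro meager_UN_countable) auto
  then have "meager (sym_diff (\<Union>i\<in>I. B i) (\<Union>i\<in>I. W i))"
    by (rule meager_subset) blast
  moreover have "cantor_open (\<Union>i\<in>I. W i)"
    using W by (intro cantor_open_Union) auto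
  ultimately show ?thesis
    unfolding Baire_property_def by blast
qed

lemma Baire_property_Un: "Baire_property A \<Longrightarrow> Baire_property B \<Longrightarrow> Baire_property (A \<union> B)"
  using Baire_property_UN_countable[of "{A, B}" id] by auto

lemma Baire_property_borel: "cantor_borel B \<Longrightarrow> Baire_property B"
proof -
  have "Baire_property (chi -` S)" if "S \<in> sigma_sets UNIV {S. open S}" for S
    using that
  proof induction
    case (Basic S)
    then show ?case
      by (intro Baire_property_open) (simp add: cantor_open_def chi_image_vimage)
  next
    case Empty
    then show ?case
      by (intro Baire_property_open) (simp add: cantor_open_iff)
  next
    case (Compl S)
    then show ?case
      using Baire_property_Compl[of "chi -` S"] by (simp only: vimage_Compl Compl_eq_Diff_UNIV[symmetric])
  next
    case (Union S)
    then show ?case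
      by (auto simp: vimage_UN intro!: Baire_property_UN_countable)
  qed
  then show "cantor_borel B \<Longrightarrow> Baire_property B"
    unfolding cantor_borel_def borel_def by (metis chi_vimage_image sets_measure_of Pow_UNIV subset_UNIV)
qed

lemma Baire_property_nonmeager:
  assumes "Baire_property B" "\<not> meager B"
  shows "\<exists>k. meager (bas k - B)"
proof -
  obtain W where W: "cantor_open W" "meager (sym_diff B W)"
    using assms unfolding Baire_property_def by blast
  then have "W \<noteq> {}"
    using assms(2) by auto
  then obtain k where "bas k \<subseteq> W"
    using open_contains_bas[OF W(1)] by blast
  then have "meager (bas k - B)"
    using W(2) by (elim meager_subset) blast
  then show ?thesis ..
qed

text \<open>If the complement were nonmeager, it would contain some \<open>bas k\<close> up to a
  meager set, leaving only a meager part of \<open>B\<close> there.\<close>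

lemma comeager_if_nonmeager_in_bas:
  assumes "Baire_property B" "\<And>k. \<not> meager (B \<inter> bas k)"
  shows "meager (- B)"
proof (rule ccontr)
  assume "\<not> meager (- B)"
  then obtain k where "meager (bas k - - B)"
    using Baire_property_nonmeager[OF Baire_property_Compl[OF assms(1)]] by blast
  then show False
    using assms(2)[of k] by (simp add: Diff_eq Int_commute)
qed

section \<open>Unions of fewer than continuum many meager sets\<close>

locale add_M_continuum =
  assumes add_M: "add_M_is (UNIV :: nat set set)"
begin

abbreviation small :: "'i set \<Rightarrow> bool" where
  "small I \<equiv> |I| <o |UNIV :: nat set set|"

lemma infinite_continuum: "infinite (UNIV :: nat set set)"
  by (simp add: Finite_Set.finite_set)

lemma small_finite: "finite I \<Longrightarrow> small I"
  using infinite_continuum by (intro finite_ordLess_infinite card_of_Well_order) (simp_all add: Field_card_of)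

lemma small_Un: "small I \<Longrightarrow> small J \<Longrightarrow> small (I \<union> J)"
  by (rule card_of_Un_ordLess_infinite[OF infinite_continuum])

lemma small_image: "small I \<Longrightarrow> small (f ` I)"
  using card_of_image ordLeq_ordLess_trans by blast

lemma small_subset: "small I \<Longrightarrow> J \<subseteq> I \<Longrightarrow> small J"
  using card_of_mono1 ordLeq_ordLess_trans by blast

lemma meager_UN_small:
  assumes "small I" "\<And>i. i \<in> I \<Longrightarrow> meager (M i)"
  shows "meager (\<Union>i\<in>I. M i)"
proof -
  have "|M ` I| <o |UNIV :: nat set set|"
    using small_image[OF assms(1)] .
  moreover have "\<forall>N\<in>M ` I. meager N"
    using assms(2) by blast
  ultimately show ?thesis
    using add_M unfolding add_M_is_def by blast
qed

lemma meager_small: "small X \<Longrightarrow> meager X"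
  using meager_UN_small[of X "\<lambda>x. {x}"] meager_singleton by simp

text \<open>Induction on the length of lists avoids the cardinal arithmetic of finite subsets.\<close>

lemma meager_UN_lists:
  assumes "small X" "\<And>xs. set xs \<subseteq> X \<Longrightarrow> meager (M xs)"
  shows "meager (\<Union>xs\<in>lists X. M xs)"
proof -
  have len: "meager (\<Union>xs\<in>{xs. set xs \<subseteq> X \<and> length xs = n}. M xs)"
    if "\<And>xs. set xs \<subseteq> X \<Longrightarrow> meager (M xs)" for n M
    using that
  proof (induction n arbitrary: M)
    case 0
    then have "meager (M [])"
      by simp
    then show ?case
      by (rule meager_subset) auto
  next
    case (Suc n)
    have "meager (\<Union>x\<in>X. \<Union>xs\<in>{xs. set xs \<subseteq> X \<and> length xs = n}. M (x # xs))"
    proof (rule meager_UN_small[OF assms(1)])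
      fix x assume "x \<in> X"
      then show "meager (\<Union>xs\<in>{xs. set xs \<subseteq> X \<and> length xs = n}. M (x # xs))"
        using Suc.prems by (intro Suc.IH) auto
    qed
    then show ?case
      by (rule meager_subset) (force simp: length_Suc_conv)
  qed
  have "meager (\<Union>n. \<Union>xs\<in>{xs. set xs \<subseteq> X \<and> length xs = n}. M xs)"
    by (rule meager_UN_countable[OF countableI_type len[OF assms(2)]])
  then show ?thesis
    by (rule meager_subset) auto
qed

lemma meager_UN_finite_subsets:
  assumes "small X" "\<And>F. finite F \<Longrightarrow> F \<subseteq> X \<Longrightarrow> meager (M F)"
  shows "meager (\<Union>F\<in>{F. finite F \<and> F \<subseteq> X}. M F)"
proof -
  have "meager (\<Union>xs\<in>lists X. M (set xs))"
    using assms by (intro meager_UN_lists) auto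
  then show ?thesis
    by (rule meager_subset) (use finite_list in fastforce)
qed

end

subsection \<open>Generic selections\<close>

text \<open>Reads \<open>A\<close>, through pairing, as a relation and takes the least element of
  row \<open>n\<close>, so that generic sets give generic functions. An empty row gets an
  unspecified value.\<close>

definition dec :: "nat set \<Rightarrow> nat \<Rightarrow> nat" where
  "dec A n = (LEAST k. prod_encode (n, k) \<in> A)"

lemma prod_encode_strict_mono2: "k' < k \<Longrightarrow> prod_encode (n, k') < prod_encode (n, k)"
  using lift_Suc_mono_less[of triangle "n + k'" "n + k"] by (simp add: prod_encode_def)

lemma meager_finite_dec:
  assumes "\<And>n. S n \<noteq> {}"
  shows "meager {A. finite {n. dec A n \<in> S n}}"
proof -
  have "nowhere_dense {A. \<forall>n\<ge>m. dec A n \<notin> S n}" for m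
    unfolding nowhere_dense_iff
  proof (intro allI)
    fix l s
    \<comment> \<open>As \<open>prod_encode (n, k')\<close> is at least \<open>n\<close>, the whole
      row \<open>n\<close> lies beyond the length \<open>l\<close> and is still free.\<close>
    define n where "n = max l m"
    obtain k where k: "k \<in> S n"
      using assms by blast
    define p where "p = prod_encode (n, k)"
    \<comment> \<open>Up to \<open>p\<close> the row \<open>n\<close> is empty except for
      \<open>p\<close> itself, which forces \<open>dec A n = k\<close>.\<close>
    define t where "t = (s \<inter> {..<l}) \<union> {p}"
    have pe: "l \<le> prod_encode (n, k')" for k'
      using le_prod_encode_1[of n k'] by (simp add: n_def)
    have "dec A n = k" if "A \<in> cyl (Suc p) t" for A
      unfolding dec_def
    proof (rule Least_equality)
      show "prod_encode (n, k) \<in> A"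
        using that by (simp add: mem_cyl t_def p_def)
      fix k' assume k': "prod_encode (n, k') \<in> A"
      show "k \<le> k'"
      proof (rule ccontr)
        assume "\<not> k \<le> k'"
        then have less: "prod_encode (n, k') < p"
          using prod_encode_strict_mono2 by (simp add: p_def)
        then have "prod_encode (n, k') \<in> t"
          using that k' by (simp add: mem_cyl)
        then show False
          using less pe[of k'] by (auto simp: t_def)
      qed
    qed
    moreover have "m \<le> n"
      by (simp add: n_def)
    ultimately have "cyl (Suc p) t \<inter> {A. \<forall>n\<ge>m. dec A n \<notin> S n} = {}"
      using k by auto
    moreover have "cyl (Suc p) t \<subseteq> cyl l s"
      using pe[of k] by (intro cyl_mono) (auto simp: mem_cyl t_def p_def)
    ultimately show "\<exists>m' t. cyl m' t \<subseteq> cyl l s \<and> cyl m' t \<inter> {A. \<forall>n\<ge>m. dec A n \<notin> S n} = {}"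
      by blast
  qed
  then have "meager (\<Union>m. {A. \<forall>n\<ge>m. dec A n \<notin> S n})"
    by (intro meager_UN_countable nowhere_dense_imp_meager) auto
  moreover have "\<exists>m. \<forall>n\<ge>m. dec A n \<notin> S n" if "finite {n. dec A n \<in> S n}" for A
    using finite_nat_bounded[OF that] by (metis lessThan_iff mem_Collect_eq not_le subsetD)
  ultimately show ?thesis
    by (elim meager_subset) blast
qed

text \<open>Fewer than continuum many requirements together exclude only a meager set of
  \<open>A\<close>, so some \<open>A\<close> meets them all.\<close>

lemma (in add_M_continuum) generic_selection:
  fixes S :: "'i \<Rightarrow> nat \<Rightarrow> nat set"
  assumes "small I" "\<And>i n. i \<in> I \<Longrightarrow> S i n \<noteq> {}"
  shows "\<exists>f. \<forall>i\<in>I. infinite {n. f n \<in> S i n}"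
proof -
  have "meager (\<Union>i\<in>I. {A. finite {n. dec A n \<in> S i n}})"
    using assms by (intro meager_UN_small meager_finite_dec) auto
  from meager_avoid[OF this] obtain A where "A \<notin> (\<Union>i\<in>I. {A. finite {n. dec A n \<in> S i n}})" ..
  then show ?thesis
    by (intro exI[of _ "dec A"]) auto
qed

subsection \<open>Selections for Luzin sets\<close>

text \<open>Infinitely many \<open>n\<close> attend to each base set, and \<open>f n\<close> takes a
  piece that is nonmeager there. If the covered points missed from \<open>m\<close> on formed a
  nonmeager set, it would fill a base set up to a meager set; an attending \<open>n\<close> \<ge>
  \<open>m\<close> then puts a nonmeager part of this base set outside.\<close>

lemma selection_modulo_meager:
  fixes B :: "nat \<Rightarrow> nat \<Rightarrow> nat set set"
  assumes BP: "\<And>n k. Baire_property (B n k)"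
  shows "\<exists>f. meager {x. (\<forall>n. \<exists>k. x \<in> B n k) \<and> finite {n. x \<in> B n (f n)}}"
proof -
  define E where "E n = bas (fst (prod_decode n))" for n
  \<comment> \<open>The choice is arbitrary when no piece is nonmeager in \<open>E n\<close>; only
    the other case is used.\<close>
  define f where "f n = (SOME k. \<not> meager (B n k \<inter> E n))" for n
  define R where "R m = {x. (\<forall>n. \<exists>k. x \<in> B n k) \<and> (\<forall>n\<ge>m. x \<notin> B n (f n))}" for m
  have "meager (R m)" for m
  proof (rule ccontr)
    assume nm: "\<not> meager (R m)"
    have "Baire_property (\<Union>n. - (\<Union>k. B n k))"
      by (intro Baire_property_UN_countable Baire_property_Compl BP) auto
    moreover have "Baire_property (\<Union>n\<in>{m..}. B n (f n))"
      by (intro Baire_property_UN_countable BP) auto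
    ultimately have "Baire_property (- ((\<Union>n. - (\<Union>k. B n k)) \<union> (\<Union>n\<in>{m..}. B n (f n))))"
      by (intro Baire_property_Compl Baire_property_Un)
    also have "- ((\<Union>n. - (\<Union>k. B n k)) \<union> (\<Union>n\<in>{m..}. B n (f n))) = R m"
      by (auto simp: R_def)
    finally obtain j where j: "meager (bas j - R m)"
      using Baire_property_nonmeager nm by blast
    define n where "n = prod_encode (j, m)"
    have nm: "m \<le> n" and En: "E n = bas j"
      by (simp_all add: n_def le_prod_encode_2 E_def)
    have "\<exists>k. \<not> meager (B n k \<inter> bas j)"
    proof (rule ccontr)
      assume "\<nexists>k. \<not> meager (B n k \<inter> bas j)"
      then have "meager ((\<Union>k. B n k \<inter> bas j) \<union> (bas j - R m))"
        using j by (intro meager_Un meager_UN_countable) auto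
      then have "meager (bas j)"
        by (rule meager_subset) (auto simp: R_def)
      then show False
        using Baire_bas by blast
    qed
    then have "\<not> meager (B n (f n) \<inter> bas j)"
      unfolding f_def En by (rule someI_ex)
    moreover have "B n (f n) \<inter> bas j \<subseteq> bas j - R m"
      using nm by (auto simp: R_def)
    ultimately show False
      using j meager_subset by blast
  qed
  then have "meager (\<Union>m. R m)"
    by (intro meager_UN_countable) auto
  moreover have "\<exists>m. \<forall>n\<ge>m. x \<notin> B n (f n)" if "finite {n. x \<in> B n (f n)}" for x
    using finite_nat_bounded[OF that] by (metis lessThan_iff mem_Collect_eq not_le subsetD)
  ultimately have "meager {x. (\<forall>n. \<exists>k. x \<in> B n k) \<and> finite {n. x \<in> B n (f n)}}"
    by (elim meager_subset) (auto simp: R_def)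
  then show ?thesis
    by (intro exI[of _ f])
qed

text \<open>The even indices serve all points outside a meager set, the odd ones the few remaining points.\<close>

lemma (in add_M_continuum) Luzin_selection:
  fixes B :: "nat \<Rightarrow> nat \<Rightarrow> nat set set"
  assumes X: "\<And>M. meager M \<Longrightarrow> small (X \<inter> M)"
    and BP: "\<And>n k. Baire_property (B n k)"
    and cov: "\<And>n x. x \<in> X \<Longrightarrow> \<exists>k. x \<in> B n k"
  shows "\<exists>f. \<forall>x\<in>X. infinite {n. x \<in> B n (f n)}"
proof -
  obtain f where f: "meager {x. (\<forall>n. \<exists>k. x \<in> B (2*n) k) \<and> finite {n. x \<in> B (2*n) (f n)}}"
    (is "meager ?M")
    using selection_modulo_meager[of "\<lambda>n. B (2*n)"] BP by blast
  obtain g where g: "\<forall>x\<in>X \<inter> ?M. infinite {n. g n \<in> {k. x \<in> B (2*n+1) k}}"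
    using generic_selection[OF X[OF f], of "\<lambda>x n. {k. x \<in> B (2*n+1) k}"] cov by blast
  define h where "h n = (if even n then f (n div 2) else g (n div 2))" for n
  have "infinite {n. x \<in> B n (h n)}" if x: "x \<in> X" for x
  proof (cases "x \<in> ?M")
    case True
    then have "infinite ((\<lambda>n. 2*n+1) ` {n. x \<in> B (2*n+1) (g n)})"
      using g x by (subst finite_image_iff) (auto simp: inj_on_def)
    then show ?thesis
      by (rule infinite_super[rotated]) (auto simp: h_def)
  next
    case False
    then have "infinite ((\<lambda>n. 2*n) ` {n. x \<in> B (2*n) (f n)})"
      using cov x by (subst finite_image_iff) (auto simp: inj_on_def)
    then show ?thesis
      by (rule infinite_super[rotated]) (auto simp: h_def)
  qed
  then show ?thesis by blast
qed

subsection \<open>Omega-fat sequences\<close>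

definition fat :: "nat set set \<Rightarrow> (nat \<Rightarrow> nat set set) \<Rightarrow> bool" where
  "fat X S \<longleftrightarrow> (\<forall>F E. finite F \<and> F \<subseteq> X \<and> finite E \<longrightarrow>
     (\<exists>n. F \<subseteq> S n \<and> (\<forall>k\<in>E. \<not> meager (S n \<inter> bas k))))"

lemma fat_subset: "fat X S \<Longrightarrow> Y \<subseteq> X \<Longrightarrow> fat Y S"
  unfolding fat_def by (meson subset_trans)

text \<open>In each \<open>bas k\<close> take a point \<open>p k\<close> of \<open>L\<close> outside
  every trace \<open>S n \<inter> bas k\<close> that is meager. A member containing
  \<open>p k\<close> is then nonmeager in \<open>bas k\<close>, so it suffices to cover
  \<open>F\<close> together with the points for \<open>E\<close>.\<close>

lemma fat_if_omega_cover:
  assumes nm: "\<And>k M. meager M \<Longrightarrow> \<not> L \<inter> bas k \<subseteq> M"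
    and cov: "\<And>F. finite F \<Longrightarrow> F \<subseteq> L \<Longrightarrow> \<exists>n. F \<subseteq> S n"
  shows "fat L S"
  unfolding fat_def
proof (intro allI impI, elim conjE)
  fix F E assume F: "finite F" "F \<subseteq> L" and E: "finite (E :: nat set)"
  have "\<exists>p. p \<in> L \<inter> bas k \<and> p \<notin> (\<Union>n\<in>{n. meager (S n \<inter> bas k)}. S n \<inter> bas k)" for k
    using nm[of "\<Union>n\<in>{n. meager (S n \<inter> bas k)}. S n \<inter> bas k" k]
    by (metis (no_types, lifting) meager_UN_countable countableI_type mem_Collect_eq subsetI)
  then obtain p where p: "\<And>k. p k \<in> L \<inter> bas k"
      "\<And>k. p k \<notin> (\<Union>n\<in>{n. meager (S n \<inter> bas k)}. S n \<inter> bas k)"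
    by metis
  obtain n where "F \<union> p ` E \<subseteq> S n"
    using cov[of "F \<union> p ` E"] F E p(1) by auto
  then have "F \<subseteq> S n \<and> (\<forall>k\<in>E. \<not> meager (S n \<inter> bas k))"
    using p by blast
  then show "\<exists>n. F \<subseteq> S n \<and> (\<forall>k\<in>E. \<not> meager (S n \<inter> bas k))" ..
qed

context add_M_continuum
begin

text \<open>The set \<open>E\<close> in \<open>fat\<close> is there for this: since any
  \<open>k\<close> may be added to \<open>E\<close>, the members that serve \<open>F\<close> and
  \<open>E\<close> have a union that is nonmeager in every base set, hence comeager. A generic
  \<open>x\<close> lies in one of them, which then serves \<open>insert x F\<close>.\<close>

lemma meager_not_fat_insert:
  assumes X: "small X" and BP: "\<And>n. Baire_property (S n)" and fat: "fat X S"
  shows "meager {x. \<not> fat (insert x X) S}"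
proof -
  define J where "J F E = {n. F \<subseteq> S n \<and> (\<forall>k\<in>E. \<not> meager (S n \<inter> bas k))}" for F E
  have "meager (- (\<Union>n\<in>J F E. S n))" if F: "finite F" "F \<subseteq> X" and E: "finite E" for F E
  proof (rule comeager_if_nonmeager_in_bas)
    show "Baire_property (\<Union>n\<in>J F E. S n)"
      by (intro Baire_property_UN_countable BP) auto
    fix k
    obtain n where "F \<subseteq> S n" "\<forall>k\<in>insert k E. \<not> meager (S n \<inter> bas k)"
      using fat F E unfolding fat_def by (meson finite.insertI)
    then have "n \<in> J F E" "\<not> meager (S n \<inter> bas k)"
      by (auto simp: J_def)
    then show "\<not> meager ((\<Union>n\<in>J F E. S n) \<inter> bas k)"
      by (metis (no_types, lifting) Int_mono UN_upper meager_subset subset_refl)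
  qed
  then have "meager (\<Union>F\<in>{F. finite F \<and> F \<subseteq> X}. \<Union>E\<in>{E. finite E}. - (\<Union>n\<in>J F E. S n))"
    by (intro meager_UN_finite_subsets[OF X] meager_UN_countable)
      (auto simp: countable_Collect_finite)
  moreover have "{x. \<not> fat (insert x X) S}
      \<subseteq> (\<Union>F\<in>{F. finite F \<and> F \<subseteq> X}. \<Union>E\<in>{E. finite E}. - (\<Union>n\<in>J F E. S n))"
  proof (intro subsetI, rule ccontr)
    fix x assume "x \<in> {x. \<not> fat (insert x X) S}"
      and x: "x \<notin> (\<Union>F\<in>{F. finite F \<and> F \<subseteq> X}. \<Union>E\<in>{E. finite E}. - (\<Union>n\<in>J F E. S n))"
    then obtain F E where FE: "finite F" "F \<subseteq> insert x X" "finite E"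
        "\<nexists>n. F \<subseteq> S n \<and> (\<forall>k\<in>E. \<not> meager (S n \<inter> bas k))"
      unfolding fat_def by blast
    have "finite (F - {x})" "F - {x} \<subseteq> X"
      using FE by auto
    then obtain n where "n \<in> J (F - {x}) E" "x \<in> S n"
      using x FE(3) by blast
    then show False
      using FE(4) by (auto simp: J_def)
  qed
  ultimately show ?thesis
    by (rule meager_subset)
qed

text \<open>Each pair \<open>F\<close>, \<open>E\<close> is a requirement on the selection, with the
  nonempty set \<open>J F E n\<close> of good values at \<open>n\<close>. The pairs are few enough
  for one generic function to meet all requirements.\<close>

lemma fat_selection:
  fixes B :: "nat \<Rightarrow> nat \<Rightarrow> nat set set"
  assumes X: "small X" and fat: "\<And>n. fat X (B n)"
  shows "\<exists>f. fat X (\<lambda>n. B n (f n))"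
proof -
  define J where "J F E n = {k. F \<subseteq> B n k \<and> (\<forall>e\<in>E. \<not> meager (B n k \<inter> bas e))}" for F E n
  have "J F E n \<noteq> {}" if FE: "finite F" "F \<subseteq> X" "finite E" for F E n
  proof -
    obtain k where "F \<subseteq> B n k \<and> (\<forall>e\<in>E. \<not> meager (B n k \<inter> bas e))"
      using fat[of n, unfolded fat_def, rule_format, of F E] FE by blast
    then have "k \<in> J F E n"
      by (simp add: J_def)
    then show ?thesis
      by blast
  qed
  then have "meager (\<Union>F\<in>{F. finite F \<and> F \<subseteq> X}. \<Union>E\<in>{E. finite E}. {A. finite {n. dec A n \<in> J F E n}})"
    by (intro meager_UN_finite_subsets[OF X] meager_UN_countable meager_finite_dec)
      (auto simp: countable_Collect_finite)
  from meager_avoid[OF this] obtain A where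
    A: "A \<notin> (\<Union>F\<in>{F. finite F \<and> F \<subseteq> X}. \<Union>E\<in>{E. finite E}. {A. finite {n. dec A n \<in> J F E n}})" ..
  have "fat X (\<lambda>n. B n (dec A n))"
    unfolding fat_def
  proof (intro allI impI, elim conjE)
    fix F E assume "finite F" "F \<subseteq> X" "finite (E :: nat set)"
    then have "infinite {n. dec A n \<in> J F E n}"
      using A by blast
    then obtain n where "dec A n \<in> J F E n"
      using infinite_imp_nonempty by blast
    then show "\<exists>n. F \<subseteq> B n (dec A n) \<and> (\<forall>k\<in>E. \<not> meager (B n (dec A n) \<inter> bas k))"
      unfolding J_def by blast
  qed
  then show ?thesis
    by (intro exI[of _ "dec A"])
qed

end

subsection \<open>Borel codes\<close>

text \<open>Codes give the Borel sets names that can be turned into sets of naturals, so that a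
  recursion along \<open>nat set\<close> reaches every double sequence of Borel sets.\<close>

datatype bcode = Base nat | Neg bcode | Join "nat \<Rightarrow> bcode"

primrec code_set :: "bcode \<Rightarrow> nat set set" where
  "code_set (Base k) = bas k"
| "code_set (Neg c) = - code_set c"
| "code_set (Join f) = (\<Union>i. code_set (f i))"

text \<open>A code as a labelled tree on finite sequences: the labels 0 and 1 mark
  \<open>Neg\<close> and \<open>Join\<close>, and the shift by 2 keeps the leaves apart from
  them.\<close>

primrec code_tree :: "bcode \<Rightarrow> nat list \<Rightarrow> nat" where
  "code_tree (Base k) = (\<lambda>p. k + 2)"
| "code_tree (Neg c) = (\<lambda>p. case p of [] \<Rightarrow> 0 | _ # q \<Rightarrow> code_tree c q)"
| "code_tree (Join f) = (\<lambda>p. case p of [] \<Rightarrow> 1 | i # q \<Rightarrow> code_tree (f i) q)"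

lemma code_tree_inject: "code_tree c = code_tree d \<Longrightarrow> c = d"
proof (induction c arbitrary: d)
  case (Base k)
  then show ?case
    by (cases d) (auto dest: fun_cong[of _ _ "[]"])
next
  case (Neg c)
  show ?case
  proof (cases d)
    case d: (Neg d')
    have "code_tree c q = code_tree d' q" for q
      using fun_cong[OF Neg.prems, of "0 # q"] d by simp
    then show ?thesis
      using Neg.IH d by blast
  qed (use fun_cong[OF Neg.prems, of "[]"] in auto)
next
  case (Join f)
  show ?case
  proof (cases d)
    case d: (Join g)
    have "code_tree (f i) q = code_tree (g i) q" for i q
      using fun_cong[OF Join.prems, of "i # q"] d by simp
    then have "f i = g i" for i
      using Join.IH by blast
    then show ?thesis
      using d by blast
  qed (use fun_cong[OF Join.prems, of "[]"] in auto)
qed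

lemma Baire_property_code_set: "Baire_property (code_set c)"
proof (induction c)
  case (Base k)
  then show ?case by (simp add: Baire_property_open cantor_open_bas)
next
  case (Neg c)
  then show ?case by (simp add: Baire_property_Compl)
next
  case (Join f)
  then show ?case by (simp add: Baire_property_UN_countable)
qed

lemma code_set_UN: "\<exists>c. code_set c = (\<Union>i. B i)"
  if "\<And>i::nat. \<exists>c. code_set c = B i"
proof -
  obtain f where "\<And>i. code_set (f i) = B i"
    using \<open>\<And>i. \<exists>c. code_set c = B i\<close> by metis
  then have "code_set (Join f) = (\<Union>i. B i)"
    by simp
  then show ?thesis ..
qed

text \<open>An open set is the union of the base sets inside it; in a \<open>Join\<close> the
  indices of the other base sets are filled with the empty set, which needs a code.\<close>

lemma code_set_empty: "\<exists>c. code_set c = {}"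
proof -
  have "(\<Union>i. bas i) = UNIV"
  proof -
    have "A \<in> (\<Union>i. bas i)" for A
      using cyl_eq_bas[of 0 A] self_mem_cyl[of A 0] by auto
    then show ?thesis
      by blast
  qed
  then have "code_set (Neg (Join Base)) = {}"
    by simp
  then show ?thesis ..
qed

lemma borel_imp_code_set: "cantor_borel B \<Longrightarrow> \<exists>c. code_set c = B"
proof -
  have "\<exists>c. code_set c = chi -` S" if "S \<in> sigma_sets UNIV {S. open S}" for S
    using that
  proof induction
    case (Basic S)
    then have U: "cantor_open (chi -` S)"
      by (simp add: cantor_open_def chi_image_vimage)
    have "\<exists>c. code_set c = (if bas k \<subseteq> chi -` S then bas k else {})" for k
      using code_set_empty code_set.simps(1) by metis
    moreover have "(\<Union>k. if bas k \<subseteq> chi -` S then bas k else {}) = chi -` S"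
      using open_contains_bas[OF U] by (auto split: if_splits) blast
    ultimately show ?case
      using code_set_UN[of "\<lambda>k. if bas k \<subseteq> chi -` S then bas k else {}"] by simp
  next
    case Empty
    then show ?case
      using code_set_empty by simp
  next
    case (Compl S)
    from Compl.IH obtain c where "code_set c = chi -` S" ..
    then have "code_set (Neg c) = chi -` (UNIV - S)"
      by (simp only: code_set.simps vimage_Compl Compl_eq_Diff_UNIV[symmetric])
    then show ?case ..
  next
    case (Union S)
    then show ?case
      unfolding vimage_UN by (intro code_set_UN)
  qed
  then show "cantor_borel B \<Longrightarrow> \<exists>c. code_set c = B"
    unfolding cantor_borel_def borel_def by (metis chi_vimage_image sets_measure_of Pow_UNIV subset_UNIV)
qed

text \<open>Closures of nowhere dense sets are closed and nowhere dense. Hence codes for Borel sets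
  capture all meager sets up to inclusion.\<close>

lemma meager_subset_borel: "meager M \<Longrightarrow> \<exists>B. cantor_borel B \<and> meager B \<and> M \<subseteq> B"
proof -
  assume "meager M"
  then obtain N :: "nat \<Rightarrow> nat set set" where N: "\<And>i. nowhere_dense (N i)" "M \<subseteq> (\<Union>i. N i)"
    unfolding meager_iff_seq by blast
  define K where "K i = chi -` closure (chi ` N i)" for i
  have chiK: "chi ` K i = closure (chi ` N i)" for i
    unfolding K_def by (rule chi_image_vimage)
  have "N i \<subseteq> K i" for i
    unfolding K_def using closure_subset[of "chi ` N i"] by blast
  then have "M \<subseteq> (\<Union>i. K i)"
    by (intro order_trans[OF N(2)] UN_mono) auto
  moreover have "nowhere_dense (K i)" for i
    using N(1)[of i] unfolding nowhere_dense_def chiK by simp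
  then have "meager (\<Union>i. K i)"
    by (intro meager_UN_countable nowhere_dense_imp_meager) auto
  moreover have "cantor_borel (\<Union>i. K i)"
    unfolding cantor_borel_def image_UN chiK by (intro sets.countable_UN) auto
  ultimately show ?thesis
    by blast
qed

text \<open>The tag records the basic open set into which the recursion puts the new point. Since every
  meager set occurs with every tag, both sequences are nowhere meager.\<close>

definition index_of :: "nat \<times> (nat \<Rightarrow> nat \<Rightarrow> bcode) \<Rightarrow> nat set" where
  "index_of = (\<lambda>(k, C). range (\<lambda>(i, j, p). to_nat (k, i, j, p, code_tree (C i j) p)))"

text \<open>\<open>index_of\<close> is the graph of the labels with the tag attached to each entry,
  and a graph determines its function.\<close>

lemma inj_index_of: "inj index_of"
proof (rule injI, safe)
  fix k k' C C'
  assume eq: "index_of (k, C) = index_of (k', C')"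
  have *: "k = k' \<and> code_tree (C i j) p = code_tree (C' i j) p" for i j p
  proof -
    have "to_nat (k, i, j, p, code_tree (C i j) p) \<in> index_of (k, C)"
      unfolding index_of_def prod.case by (rule range_eqI[of _ _ "(i, j, p)"]) simp
    then have "to_nat (k, i, j, p, code_tree (C i j) p) \<in> index_of (k', C')"
      using eq by simp
    then show ?thesis
      unfolding index_of_def by auto
  qed
  then show "k = k'" by blast
  from * have "C i j = C' i j" for i j
    by (intro code_tree_inject ext) blast
  then show "C = C'" by blast
qed

definition tag :: "nat set \<Rightarrow> nat" where
  "tag a = fst (inv index_of a)"

definition borel_seq :: "nat set \<Rightarrow> nat \<Rightarrow> nat \<Rightarrow> nat set set" where
  "borel_seq a i j = code_set (snd (inv index_of a) i j)"

text \<open>Only one entry of the double sequence counts; the empty default keeps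
  \<open>meager_set a\<close> meager for every index.\<close>

definition meager_set :: "nat set \<Rightarrow> nat set set" where
  "meager_set a = (if meager (borel_seq a 0 0) then borel_seq a 0 0 else {})"

lemma Baire_property_borel_seq: "Baire_property (borel_seq a i j)"
  by (simp add: borel_seq_def Baire_property_code_set)

lemma meager_meager_set: "meager (meager_set a)"
  by (simp add: meager_set_def meager_empty)

lemma ex_index:
  assumes "\<And>i j. cantor_borel (B i j)"
  shows "\<exists>a. tag a = k \<and> borel_seq a = B"
proof -
  obtain C where "\<And>i j. code_set (C i j) = B i j"
    using borel_imp_code_set[OF assms] by metis
  then have "tag (index_of (k, C)) = k" "borel_seq (index_of (k, C)) = B"
    by (auto simp: tag_def borel_seq_def inv_f_f[OF inj_index_of] fun_eq_iff)
  then show ?thesis by blast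
qed

lemma ex_index_meager:
  assumes "meager M"
  shows "\<exists>a. tag a = k \<and> M \<subseteq> meager_set a"
proof -
  obtain B where B: "cantor_borel B" "meager B" "M \<subseteq> B"
    using meager_subset_borel[OF assms] by blast
  obtain a where "tag a = k" "borel_seq a = (\<lambda>_ _. B)"
    using ex_index[of "\<lambda>_ _. B"] B(1) by blast
  then show ?thesis
    using B by (intro exI[of _ a]) (simp add: meager_set_def)
qed

subsection \<open>The recursion\<close>

text \<open>The order is the cardinal order of the continuum, so each stage has fewer than continuum
  many predecessors.\<close>

definition below :: "nat set \<Rightarrow> nat set set" where
  "below a = underS |UNIV| a"

lemma below_trans:
  assumes "a \<in> below b" "b \<in> below c"
  shows "a \<in> below c"
proof -
  have "trans |UNIV :: nat set set|" "antisym |UNIV :: nat set set|"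
    using card_of_Well_order[of "UNIV :: nat set set"] by (simp_all add: order_on_defs)
  then show ?thesis
    using assms unfolding below_def underS_def by (auto dest: transD antisymD)
qed

lemma below_total: "a = b \<or> a \<in> below b \<or> b \<in> below a"
  using card_of_Well_order[of "UNIV :: nat set set"]
  unfolding below_def underS_def well_order_on_def linear_order_on_def total_on_def Field_card_of
  by blast

lemma wf_below: "wf {(a, b). a \<in> below b}"
proof -
  have "wf ( |UNIV :: nat set set| - Id)"
    using card_of_Well_order[of "UNIV :: nat set set"] by (simp add: well_order_on_def)
  then show ?thesis
    by (rule wf_subset) (auto simp: below_def underS_def)
qed

lemma finite_below_max:
  assumes "finite F" "F \<noteq> {}"
  shows "\<exists>c\<in>F. F \<subseteq> insert c (below c)"
  using assms
proof (induction rule: finite_ne_induct)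
  case (insert a F)
  then obtain c where c: "c \<in> F" "F \<subseteq> insert c (below c)"
    by blast
  consider "a = c \<or> a \<in> below c" | "c \<in> below a"
    using below_total by blast
  then show ?case
  proof cases
    case 1
    then show ?thesis
      using c by (intro bexI[of _ c]) auto
  next
    case 2
    then have "F \<subseteq> below a"
      using c(2) below_trans by blast
    then show ?thesis by blast
  qed
qed simp

lemma (in add_M_continuum) small_below: "small (below a)"
  unfolding below_def by (rule card_of_underS[OF card_of_Card_order]) (simp add: Field_card_of)

definition sel :: "nat set set \<Rightarrow> (nat \<Rightarrow> nat \<Rightarrow> nat set set) \<Rightarrow> nat \<Rightarrow> nat" where
  "sel X B = (SOME f. fat X (\<lambda>n. B n (f n)))"

text \<open>The selection is fixed at stage \<open>b\<close> from the points below \<open>b\<close>,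
  so later stages do not alter it. Where no fat selection exists, \<open>sel\<close> is
  arbitrary.\<close>

definition sel_seq :: "(nat set \<Rightarrow> nat set) \<Rightarrow> nat set \<Rightarrow> nat \<Rightarrow> nat set set" where
  "sel_seq u b n = borel_seq b n (sel (u ` below b) (borel_seq b) n)"

text \<open>Fatness is only asked to be preserved, so the condition makes sense for every
  \<open>b\<close>, including those whose selection is not fat. The index \<open>a\<close> itself is
  included, so that the point avoids the meager set named at its own stage.\<close>

definition generic_at :: "(nat set \<Rightarrow> nat set) \<Rightarrow> nat set \<Rightarrow> nat set \<Rightarrow> bool" where
  "generic_at u a v \<longleftrightarrow> (\<forall>b\<in>insert a (below a). v \<notin> meager_set b \<and>
     (fat (u ` below a) (sel_seq u b) \<longrightarrow> fat (insert v (u ` below a)) (sel_seq u b)))"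

lemma generic_at_cong:
  assumes "\<And>b. b \<in> below a \<Longrightarrow> u b = u' b"
  shows "generic_at u a v = generic_at u' a v"
proof -
  have im: "u ` below b = u' ` below b" if "b \<in> insert a (below a)" for b
    using that assms below_trans by (intro image_cong) auto
  then have "sel_seq u b = sel_seq u' b" if "b \<in> insert a (below a)" for b
    using that by (simp add: sel_seq_def fun_eq_iff)
  then show ?thesis
    unfolding generic_at_def using im[of a] by simp
qed

lemma meager_finite_Int:
  assumes "infinite D"
  shows "meager {x. finite (x \<inter> D)}"
proof -
  have "nowhere_dense {x. x \<inter> D \<subseteq> {..<m}}" for m
    unfolding nowhere_dense_iff
  proof (intro allI)
    fix l s
    obtain d where d: "d \<in> D" "d > max l m"
      using assms by (meson infinite_nat_iff_unbounded)
    have "cyl (Suc d) (insert d s) \<subseteq> cyl l s"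
      using d by (intro cyl_mono) (auto simp: mem_cyl)
    moreover have "d \<in> x" if "x \<in> cyl (Suc d) (insert d s)" for x
      using that by (simp add: mem_cyl)
    then have "cyl (Suc d) (insert d s) \<inter> {x. x \<inter> D \<subseteq> {..<m}} = {}"
      using d by fastforce
    ultimately show "\<exists>n t. cyl n t \<subseteq> cyl l s \<and> cyl n t \<inter> {x. x \<inter> D \<subseteq> {..<m}} = {}"
      by blast
  qed
  then have "meager (\<Union>m. {x. x \<inter> D \<subseteq> {..<m}})"
    by (intro meager_UN_countable nowhere_dense_imp_meager) auto
  then show ?thesis
    by (rule meager_subset) (auto simp: finite_nat_bounded)
qed

lemma sym_diff_sym_diff: "sym_diff (sym_diff x C) C = x"
  by blast

lemma meager_avoid_in_bas: "meager M \<Longrightarrow> \<exists>x. x \<in> bas k \<and> x \<notin> M"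
  using Baire_bas meager_subset by blast

text \<open>Choose the translated point in \<open>bas k\<close> off the translate of
  \<open>M\<close> and translate back; this serves stages whose tag addresses the second
  sequence.\<close>

lemma meager_avoid_in_bas_translate:
  assumes "meager M"
  shows "\<exists>x. sym_diff x C \<in> bas k \<and> x \<notin> M"
proof -
  obtain z where "z \<in> bas k" "z \<notin> {x. sym_diff x C \<in> M}"
    using meager_avoid_in_bas[OF meager_translate[OF assms]] by blast
  then show ?thesis
    by (intro exI[of _ "sym_diff z C"]) (simp add: sym_diff_sym_diff)
qed

context add_M_continuum
begin

text \<open>Each of fewer than continuum many \<open>b\<close> excludes only a meager set of
  \<open>v\<close>.\<close>

lemma meager_not_generic: "meager {v. \<not> generic_at u a v}"
proof -
  let ?X = "u ` below a"
  have "meager (meager_set b \<union> {v. fat ?X (sel_seq u b) \<and> \<not> fat (insert v ?X) (sel_seq u b)})" for b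
  proof (intro meager_Un meager_meager_set)
    have "Baire_property (sel_seq u b n)" for n
      by (simp add: sel_seq_def Baire_property_borel_seq)
    then show "meager {v. fat ?X (sel_seq u b) \<and> \<not> fat (insert v ?X) (sel_seq u b)}"
      using meager_not_fat_insert[OF small_image[OF small_below], of "sel_seq u b"]
      by (cases "fat ?X (sel_seq u b)") (simp_all add: meager_empty)
  qed
  moreover have "small (insert a (below a))"
    using small_Un[OF small_finite[of "{a}"] small_below[of a]] by simp
  ultimately have "meager (\<Union>b\<in>insert a (below a).
      meager_set b \<union> {v. fat ?X (sel_seq u b) \<and> \<not> fat (insert v ?X) (sel_seq u b)})"
    by (intro meager_UN_small)
  then show ?thesis
    by (rule meager_subset) (auto simp: generic_at_def)
qed

end

section \<open>Admissible pairs and the growing filter\<close>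

definition meet :: "(nat set \<Rightarrow> nat set \<times> nat set) \<Rightarrow> nat set set \<Rightarrow> nat set" where
  "meet p F = (\<Inter>b\<in>F. fst (p b) \<inter> snd (p b))"

text \<open>The pair \<open>q\<close> holds the points of stage \<open>a\<close> for the two
  sequences. The Boolean in the tag says which of them must enter \<open>bas k\<close>, so each
  sequence gets its turn for every base set; the last clause keeps the finite intersections
  infinite.\<close>

definition admissible :: "(nat set \<Rightarrow> nat set \<times> nat set) \<Rightarrow> nat set \<Rightarrow> nat set \<times> nat set \<Rightarrow> bool" where
  "admissible p a q \<longleftrightarrow>
     (fst q \<inter> snd q \<subseteq> a \<or> fst q \<inter> snd q \<subseteq> - a) \<and>
     generic_at (fst \<circ> p) a (fst q) \<and> generic_at (snd \<circ> p) a (snd q) \<and>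
     (case from_nat (tag a) of (b, k) \<Rightarrow> (if b then fst q else snd q) \<in> bas k) \<and>
     (\<forall>F. finite F \<and> F \<subseteq> below a \<longrightarrow> infinite (fst q \<inter> snd q \<inter> meet p F))"

text \<open>The last clause of \<open>admissible\<close> at the latest index of \<open>F\<close>,
  applied to the remaining indices, already gives the claim.\<close>

lemma infinite_meet:
  assumes "\<And>b. b \<in> D \<Longrightarrow> admissible p b (p b)" "finite F" "F \<subseteq> D"
  shows "infinite (meet p F)"
proof (cases "F = {}")
  case False
  then obtain c where c: "c \<in> F" "F \<subseteq> insert c (below c)"
    using finite_below_max assms(2) by blast
  have "finite (F - {c})" "F - {c} \<subseteq> below c"
    using c assms(2) by auto
  then have "infinite (fst (p c) \<inter> snd (p c) \<inter> meet p (F - {c}))"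
    using assms(1)[of c] c(1) assms(3) unfolding admissible_def by blast
  moreover have "fst (p c) \<inter> snd (p c) \<inter> meet p (F - {c}) = meet p F"
    using c(1) unfolding meet_def by blast
  ultimately show ?thesis by simp
qed (simp add: meet_def)

context add_M_continuum
begin

lemma ex_admissible:
  assumes prev: "\<And>b. b \<in> below a \<Longrightarrow> admissible p b (p b)"
  shows "\<exists>q. admissible p a q"
proof -
  \<comment> \<open>The ultrafilter dichotomy: failures at \<open>F\<close> and \<open>G\<close>
    would leave \<open>meet p (F \<union> G)\<close> finite.\<close>
  have "(\<forall>F. finite F \<and> F \<subseteq> below a \<longrightarrow> infinite (a \<inter> meet p F)) \<or>
        (\<forall>F. finite F \<and> F \<subseteq> below a \<longrightarrow> infinite (- a \<inter> meet p F))"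
  proof (rule ccontr)
    assume "\<not> ?thesis"
    then obtain F G where FG: "finite F" "F \<subseteq> below a" "finite (a \<inter> meet p F)"
        "finite G" "G \<subseteq> below a" "finite (- a \<inter> meet p G)"
      by blast
    have "meet p (F \<union> G) \<subseteq> (a \<inter> meet p F) \<union> (- a \<inter> meet p G)"
      unfolding meet_def by blast
    then have "finite (meet p (F \<union> G))"
      using FG by (meson finite_Un finite_subset)
    then show False
      using infinite_meet[of "below a" p "F \<union> G"] prev FG by blast
  qed
  then obtain A where A: "A = a \<or> A = - a"
      and inf: "\<And>F. finite F \<Longrightarrow> F \<subseteq> below a \<Longrightarrow> infinite (A \<inter> meet p F)"
    by blast
  \<comment> \<open>The three parts exclude that \<open>x\<close> is not generic, that its translate
    is not generic, and that \<open>x \<inter> A\<close> has finite intersection with some finite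
    meet.\<close>
  define M where "M = {x. \<not> generic_at (fst \<circ> p) a x}
    \<union> {x. sym_diff x (- A) \<in> {z. \<not> generic_at (snd \<circ> p) a z}}
    \<union> (\<Union>F\<in>{F. finite F \<and> F \<subseteq> below a}. {x. finite (x \<inter> (A \<inter> meet p F))})"
  have "meager M"
    unfolding M_def using inf
    by (intro meager_Un meager_translate meager_not_generic
        meager_UN_finite_subsets small_below meager_finite_Int) auto
  obtain b k where bk: "from_nat (tag a) = (b::bool, k::nat)"
    by fastforce
  have "\<exists>x. (if b then x else sym_diff x (- A)) \<in> bas k \<and> x \<notin> M"
    using meager_avoid_in_bas[OF \<open>meager M\<close>, of k]
      meager_avoid_in_bas_translate[OF \<open>meager M\<close>, of "- A" k] by (cases b) auto
  then obtain x where x: "(if b then x else sym_diff x (- A)) \<in> bas k" "x \<notin> M"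
    by blast
  define z where "z = sym_diff x (- A)"
  \<comment> \<open>On \<open>A\<close> the two points agree, and off \<open>A\<close> they are
    complementary.\<close>
  have xz: "x \<inter> z = x \<inter> A"
    unfolding z_def by blast
  have "generic_at (fst \<circ> p) a x" "generic_at (snd \<circ> p) a z"
    using x(2) unfolding M_def z_def by blast+
  moreover have "infinite (x \<inter> z \<inter> meet p F)" if "finite F" "F \<subseteq> below a" for F
    using x(2) that unfolding M_def xz Int_assoc by blast
  moreover have "(if b then x else z) \<in> bas k"
    using x(1) by (simp only: z_def)
  moreover have "x \<inter> z \<subseteq> a \<or> x \<inter> z \<subseteq> - a"
    using A xz by blast
  ultimately have "admissible p a (x, z)"
    unfolding admissible_def by (cases b) (simp_all add: bk)
  then show ?thesis ..
qed

text \<open>Choice along the well-order; its first goal is that \<open>admissible\<close> at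
  \<open>a\<close> depends only on the values below \<open>a\<close>.\<close>

lemma ex_admissible_function: "\<exists>p. \<forall>a. admissible p a (p a)"
proof (rule dependent_wf_choice[OF wf_below])
  fix f g :: "nat set \<Rightarrow> nat set \<times> nat set" and a q
  assume eq: "\<And>b. (b, a) \<in> {(b, a). b \<in> below a} \<Longrightarrow> f b = g b"
  have "meet f F = meet g F" if "F \<subseteq> below a" for F
    unfolding meet_def using that eq by (intro INF_cong) auto
  then have m: "(\<forall>F. finite F \<and> F \<subseteq> below a \<longrightarrow> infinite (D \<inter> meet f F)) \<longleftrightarrow>
      (\<forall>F. finite F \<and> F \<subseteq> below a \<longrightarrow> infinite (D \<inter> meet g F))" for D
    by auto
  have g: "generic_at (fst \<circ> f) a v = generic_at (fst \<circ> g) a v"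
      "generic_at (snd \<circ> f) a v = generic_at (snd \<circ> g) a v" for v
    using eq by (intro generic_at_cong; simp)+
  show "admissible f a q = admissible g a q"
    unfolding admissible_def m g ..
next
  fix a and f :: "nat set \<Rightarrow> nat set \<times> nat set"
  assume "\<And>b. (b, a) \<in> {(b, a). b \<in> below a} \<Longrightarrow> admissible f b (f b)"
  then show "\<exists>q. admissible f a q"
    by (intro ex_admissible) simp
qed

end

section \<open>One generic sequence: Luzin property and selection from omega-covers\<close>

locale generic_sequence = add_M_continuum +
  fixes u :: "nat set \<Rightarrow> nat set"
  assumes generic: "\<And>a. generic_at u a (u a)"
    and dense: "\<And>k. \<exists>t. \<forall>a. tag a = t \<longrightarrow> u a \<in> bas k"
begin

lemma not_meager_set: "b \<in> insert a (below a) \<Longrightarrow> u a \<notin> meager_set b"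
  using generic[of a] unfolding generic_at_def by blast

text \<open>Some index names a superset of \<open>M\<close> and carries the tag that forces its
  point into \<open>bas k\<close>; that point avoids \<open>M\<close>.\<close>

lemma nowhere_meager:
  assumes "meager M"
  shows "\<not> range u \<inter> bas k \<subseteq> M"
proof -
  obtain t where t: "\<And>a. tag a = t \<Longrightarrow> u a \<in> bas k"
    using dense by blast
  obtain a where "tag a = t" "M \<subseteq> meager_set a"
    using ex_index_meager[OF assms] by blast
  then show ?thesis
    using t not_meager_set[of a a] by blast
qed

text \<open>All points from the stage naming a superset of \<open>M\<close> on avoid
  \<open>M\<close>.\<close>

lemma small_Int_meager:
  assumes "meager M"
  shows "small (range u \<inter> M)"
proof -
  obtain b where b: "M \<subseteq> meager_set b"
    using ex_index_meager[OF assms] by blast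
  have "range u \<inter> M \<subseteq> u ` below b"
  proof
    fix x assume "x \<in> range u \<inter> M"
    then obtain a where a: "x = u a" "u a \<in> M" by blast
    then have "b \<notin> insert a (below a)"
      using not_meager_set b by blast
    then have "a \<in> below b"
      using below_total by blast
    then show "x \<in> u ` below b"
      using a by blast
  qed
  then show ?thesis
    using small_image[OF small_below] small_subset by blast
qed

lemma luzin_range: "luzin (UNIV :: nat set set) (range u)"
proof -
  \<comment> \<open>A small range would be meager, contradicting
    \<open>nowhere_meager\<close>.\<close>
  have "\<not> small (range u)"
    using nowhere_meager meager_small by blast
  then have "|UNIV :: nat set set| \<le>o |range u|"
    by (simp add: not_ordLess_iff_ordLeq card_of_Well_order)
  then show ?thesis
    unfolding luzin_def using small_Int_meager by blast
qed

text \<open>The covers \<open>B\<close> are named at some stage \<open>b\<close>, whose selection is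
  fat for the earlier points; genericity carries its fatness through all later stages.\<close>

lemma omega_selection:
  fixes B :: "nat \<Rightarrow> nat \<Rightarrow> nat set set"
  assumes borel: "\<And>n k. cantor_borel (B n k)"
    and cov: "\<And>n F. finite F \<Longrightarrow> F \<subseteq> range u \<Longrightarrow> \<exists>k. F \<subseteq> B n k"
  shows "\<exists>f. \<forall>F. finite F \<and> F \<subseteq> range u \<longrightarrow> (\<exists>n. F \<subseteq> B n (f n))"
proof -
  obtain b where b: "borel_seq b = B"
    using ex_index[of B] borel by blast
  define S where "S = sel_seq u b"
  have "fat (u ` below b) (B n)" for n
    using fat_if_omega_cover[OF nowhere_meager cov, of n] by (rule fat_subset) auto
  then have "\<exists>f. fat (u ` below b) (\<lambda>n. B n (f n))"
    by (intro fat_selection small_image small_below)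
  then have start: "fat (u ` below b) S"
    unfolding S_def sel_seq_def b sel_def by (rule someI_ex)
  have fat: "fat (u ` insert a (below a)) S" if "b \<in> insert a (below a)" for a
    using that
  proof (induction a rule: wf_induct_rule[OF wf_below])
    case (1 a)
    have "fat (u ` below a) S"
    proof (cases "a = b")
      case False
      then have ba: "b \<in> below a"
        using 1(2) by blast
      show ?thesis
        unfolding fat_def
      proof (intro allI impI, elim conjE)
        fix F E assume "finite F" "F \<subseteq> u ` below a" and E: "finite (E :: nat set)"
        then obtain G where G: "finite G" "G \<subseteq> below a" "F = u ` G"
          by (meson finite_subset_image)
        \<comment> \<open>Adding \<open>b\<close> to the finite set keeps the maximum
          \<open>c\<close> from falling below \<open>b\<close>, so the induction hypothesis applies
          at \<open>c\<close>.\<close>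
        obtain c where c: "c \<in> insert b G" "insert b G \<subseteq> insert c (below c)"
          using finite_below_max[of "insert b G"] G by blast
        then have "c \<in> below a"
          using ba G by blast
        then have "fat (u ` insert c (below c)) S"
          using 1(1) c(2) by blast
        moreover have "F \<subseteq> u ` insert c (below c)"
          using G c by blast
        ultimately show "\<exists>n. F \<subseteq> S n \<and> (\<forall>k\<in>E. \<not> meager (S n \<inter> bas k))"
          unfolding fat_def using \<open>finite F\<close> E by blast
      qed
    qed (use start in simp)
    then show ?case
      using generic[of a] 1(2) unfolding generic_at_def S_def by auto
  qed
  have "\<exists>n. F \<subseteq> S n" if F: "finite F" "F \<subseteq> range u" for F
  proof -
    obtain G where G: "finite G" "F = u ` G"
      using F by (meson finite_subset_image)
    obtain c where c: "c \<in> insert b G" "insert b G \<subseteq> insert c (below c)"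
      using finite_below_max[of "insert b G"] G by blast
    then have *: "fat (u ` insert c (below c)) S" "F \<subseteq> u ` insert c (below c)"
      using fat G by blast+
    show ?thesis
      using *(1)[unfolded fat_def, rule_format, of F "{}"] *(2) F(1) by auto
  qed
  then show ?thesis
    by (intro exI[of _ "sel (u ` below b) B"]) (simp add: S_def sel_seq_def b)
qed

end

subsection \<open>Splitting covers\<close>

lemma distinct_representatives:
  fixes K :: "nat \<Rightarrow> 'a set"
  assumes "\<And>m. m < card (K m)"
  shows "\<exists>c. inj c \<and> (\<forall>m. c m \<in> K m)"
proof -
  have "\<exists>c. \<forall>m. c m \<in> K m - c ` {..<m}"
  proof (rule dependent_wf_choice[OF wf_less_than])
    fix f g :: "nat \<Rightarrow> 'a" and m r
    assume "\<And>z. (z, m) \<in> less_than \<Longrightarrow> f z = g z"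
    then have "f ` {..<m} = g ` {..<m}"
      by (intro image_cong) auto
    then show "(r \<in> K m - f ` {..<m}) = (r \<in> K m - g ` {..<m})"
      by simp
  next
    fix m and f :: "nat \<Rightarrow> 'a"
    have "card (f ` {..<m}) \<le> m"
      using card_image_le[of "{..<m}" f] by simp
    then have "\<not> K m \<subseteq> f ` {..<m}"
      using assms[of m] card_mono[of "f ` {..<m}" "K m"] by auto
    then show "\<exists>r. r \<in> K m - f ` {..<m}"
      by blast
  qed
  then obtain c where c: "\<And>m. c m \<in> K m - c ` {..<m}"
    by metis
  have neq: "c i \<noteq> c j" if "i < j" for i j
  proof
    assume "c i = c j"
    then have "c j \<in> c ` {..<j}"
      using that by (metis imageI lessThan_iff)
    then show False
      using c[of j] by simp
  qed
  have "inj c"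
    by (intro injI) (metis neq linorder_neqE_nat)
  moreover have "\<forall>m. c m \<in> K m"
    using c by simp
  ultimately show ?thesis
    by (intro exI[of _ c] conjI)
qed

lemma split_representatives:
  fixes K :: "nat \<Rightarrow> 'a set"
  assumes "\<And>n. K n \<subseteq> U" "\<And>n. card (K n) = 2*n + 2"
  shows "\<exists>a b. inj a \<and> inj b \<and> range a \<inter> range b = {} \<and> (\<forall>n. a n \<in> K n \<and> b n \<in> K n)"
proof -
  \<comment> \<open>Each \<open>K n\<close> serves the two indices \<open>2*n\<close> and
    \<open>2*n+1\<close>; its \<open>2*n + 2\<close> elements exceed both.\<close>
  have "m < card (K (m div 2))" for m
    using assms(2) by simp
  then obtain c where c: "inj c" "\<And>m. c m \<in> K (m div 2)"
    using distinct_representatives[of "\<lambda>m. K (m div 2)"] by blast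
  define a b where "a n = c (2*n)" and "b n = c (2*n+1)" for n
  have "inj a" "inj b"
    unfolding a_def b_def by (auto intro!: injI dest!: injD[OF c(1)])
  moreover have "a i \<noteq> b j" for i j
  proof
    assume "a i = b j"
    then have "2*i = 2*j+1"
      unfolding a_def b_def by (rule injD[OF c(1)])
    then show False
      by presburger
  qed
  then have "range a \<inter> range b = {}"
    by auto
  moreover have "\<forall>n. a n \<in> K n \<and> b n \<in> K n"
  proof
    fix n
    show "a n \<in> K n \<and> b n \<in> K n"
      using c(2)[of "2*n"] c(2)[of "2*n+1"] by (simp add: a_def b_def)
  qed
  ultimately show ?thesis
    by (intro exI conjI)
qed

definition subfamilies :: "'a set \<Rightarrow> nat \<Rightarrow> 'a set set" where
  "subfamilies U n = {K. K \<subseteq> U \<and> finite K \<and> card K = 2*n + 2}"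

lemma countable_subfamilies: "countable U \<Longrightarrow> countable (subfamilies U n)"
  unfolding subfamilies_def
  by (rule countable_subset[OF _ countable_Collect_finite_subset[of U]]) auto

lemma subfamily_nonempty:
  assumes "K \<in> subfamilies U n"
  shows "K \<noteq> {}"
  using assms unfolding subfamilies_def by auto

lemma ex_subfamily:
  assumes "infinite {u\<in>U. P u}"
  shows "\<exists>K\<in>subfamilies U n. \<forall>u\<in>K. P u"
proof -
  obtain K where "K \<subseteq> {u\<in>U. P u}" "finite K" "card K = 2*n + 2"
    using infinite_arbitrarily_large[OF assms] by blast
  then show ?thesis
    unfolding subfamilies_def by blast
qed

text \<open>Two injective choices from \<open>K\<close> with disjoint ranges split \<open>U\<close>:
  the first range is one part, and its complement, which contains the second range, is the
  other.\<close>

lemma Split_if_subfamilies: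
  assumes "\<And>U. U \<in> \<AA> \<Longrightarrow> \<exists>K. (\<forall>n. K n \<in> subfamilies U n) \<and>
      (\<forall>a. inj a \<and> (\<forall>n. a n \<in> K n) \<longrightarrow> range a \<in> \<BB>)"
  shows "Split \<AA> \<BB>"
  unfolding Split_def
proof
  fix U assume "U \<in> \<AA>"
  from assms[OF this] obtain K where K: "\<forall>n. K n \<in> subfamilies U n"
      and *: "\<forall>a. inj a \<and> (\<forall>n. a n \<in> K n) \<longrightarrow> range a \<in> \<BB>"
    by (elim exE conjE)
  have KU: "K n \<subseteq> U" "card (K n) = 2*n + 2" for n
    using K[rule_format, of n] by (simp_all add: subfamilies_def)
  from split_representatives[of K U, OF KU] obtain a b
    where ab: "inj a" "inj b" "range a \<inter> range b = {}" "\<forall>n. a n \<in> K n \<and> b n \<in> K n"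
    by (elim exE conjE)
  have aU: "range a \<subseteq> U" and bU: "range b \<subseteq> U"
    using KU(1) ab(4) by auto
  show "\<exists>\<V> \<W>. \<V> \<union> \<W> = U \<and> \<V> \<inter> \<W> = {} \<and> (\<exists>\<V>'\<subseteq>\<V>. \<V>' \<in> \<BB>) \<and> (\<exists>\<W>'\<subseteq>\<W>. \<W>' \<in> \<BB>)"
  proof (intro exI conjI)
    show "range a \<union> (U - range a) = U" "range a \<inter> (U - range a) = {}"
      using aU by auto
    show "range a \<subseteq> range a" "range b \<subseteq> U - range a"
      using bU ab(3) by auto
    show "range a \<in> \<BB>" "range b \<in> \<BB>"
      using * ab by simp_all
  qed
qed

lemma cantor_borel_INT:
  assumes "finite K" "K \<noteq> {}" "\<And>u. u \<in> K \<Longrightarrow> cantor_borel (h u)"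
  shows "cantor_borel (\<Inter>u\<in>K. h u)"
proof -
  obtain j where "j \<in> K"
    using assms(2) by blast
  then have "chi ` (\<Inter>u\<in>K. h u) = (\<Inter>u\<in>K. chi ` h u)"
    by (intro image_INT[OF inj_chi]) auto
  then show ?thesis
    using assms unfolding cantor_borel_def by (auto intro!: sets.finite_INT)
qed

lemma borel_in_INT:
  assumes "finite K" "K \<noteq> {}" "\<And>u. u \<in> K \<Longrightarrow> borel_in X u"
  shows "borel_in X (\<Inter>K)"
proof -
  obtain h where h: "\<And>u. u \<in> K \<Longrightarrow> cantor_borel (h u) \<and> u = X \<inter> h u"
    using assms(3) unfolding borel_in_def by metis
  then have "\<Inter>K = X \<inter> (\<Inter>u\<in>K. h u)"
    using assms(2) by blast
  then show ?thesis
    unfolding borel_in_def using cantor_borel_INT[OF assms(1,2)] h by blast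
qed

lemma omega_coverD:
  assumes "omega_cover X U"
  shows "is_cover X U" "finite F \<Longrightarrow> F \<subseteq> X \<Longrightarrow> \<exists>u\<in>U. F \<subseteq> u"
  using assms by (simp_all add: omega_cover_def)

lemma omega_coverI:
  assumes "\<And>u. u \<in> U \<Longrightarrow> u \<subseteq> X \<and> \<not> X \<subseteq> u"
    and "\<And>F. finite F \<Longrightarrow> F \<subseteq> X \<Longrightarrow> \<exists>u\<in>U. F \<subseteq> u"
  shows "omega_cover X U"
proof -
  have "x \<in> \<Union>U" if "x \<in> X" for x
    using assms(2)[of "{x}"] that by auto
  then have "is_cover X U"
    using assms(1) unfolding is_cover_def by auto
  then show ?thesis
    using assms(2) by (simp add: omega_cover_def)
qed

lemma B_OmegaD:
  assumes "U \<in> B_Omega X"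
  shows "countable U" "omega_cover X U" "u \<in> U \<Longrightarrow> borel_in X u"
  using assms by (simp_all add: B_Omega_def)

lemma B_OmegaI:
  assumes "countable U" "\<And>u. u \<in> U \<Longrightarrow> borel_in X u" "\<And>u. u \<in> U \<Longrightarrow> \<not> X \<subseteq> u"
    and "\<And>F. finite F \<Longrightarrow> F \<subseteq> X \<Longrightarrow> \<exists>u\<in>U. F \<subseteq> u"
  shows "U \<in> B_Omega X"
proof -
  have "u \<subseteq> X" if "u \<in> U" for u
    using assms(2)[OF that] by (auto simp: borel_in_def)
  then have "omega_cover X U"
    using assms(3,4) by (intro omega_coverI) auto
  then show ?thesis
    using assms(1,2) by (simp add: B_Omega_def)
qed

lemma is_coverD: "is_cover X U \<Longrightarrow> u \<in> U \<Longrightarrow> \<not> X \<subseteq> u"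
  by (simp add: is_cover_def)

text \<open>If only finitely many members contained \<open>F\<close>, adding to \<open>F\<close> a
  point missed by each of them would give a finite set that no member contains.\<close>

lemma omega_cover_infinite:
  assumes "omega_cover X U" "finite F" "F \<subseteq> X"
  shows "infinite {u\<in>U. F \<subseteq> u}"
proof
  assume fin: "finite {u\<in>U. F \<subseteq> u}"
  have "\<exists>x. x \<in> X \<and> x \<notin> u" if "u \<in> U" for u
    using is_coverD[OF omega_coverD(1)[OF assms(1)] that] by blast
  then obtain y where y: "\<And>u. u \<in> U \<Longrightarrow> y u \<in> X \<and> y u \<notin> u"
    by metis
  have "finite (F \<union> y ` {u\<in>U. F \<subseteq> u})" "F \<union> y ` {u\<in>U. F \<subseteq> u} \<subseteq> X"
    using assms fin y by auto
  from omega_coverD(2)[OF assms(1) this] obtain u where "u \<in> U" "F \<subseteq> u" "y ` {u\<in>U. F \<subseteq> u} \<subseteq> u"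
    by auto
  then have "y u \<in> u"
    by blast
  then show False
    using y[OF \<open>u \<in> U\<close>] by simp
qed

text \<open>Any \<open>a n\<close> in \<open>K n\<close> contains the intersection selected from
  \<open>W n\<close>, so every choice from the \<open>K n\<close> is again an omega-cover.\<close>

lemma S1_imp_Split_B_Omega:
  assumes S1: "S1 (B_Omega X) (B_Omega X)"
  shows "Split (B_Omega X) (B_Omega X)"
proof (rule Split_if_subfamilies)
  fix U assume U: "U \<in> B_Omega X"
  note oc = B_OmegaD(2)[OF U]
  define W where "W n = Inter ` subfamilies U n" for n
  have W: "W n \<in> B_Omega X" for n
  proof (rule B_OmegaI)
    show "countable (W n)"
      unfolding W_def by (intro countable_image countable_subfamilies B_OmegaD(1)[OF U])
    fix w assume "w \<in> W n"
    then obtain K where K: "w = \<Inter>K" "K \<in> subfamilies U n"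
      unfolding W_def by blast
    have K': "K \<subseteq> U" "finite K" "K \<noteq> {}"
      using K(2) subfamily_nonempty[OF K(2)] by (simp_all add: subfamilies_def)
    show "borel_in X w"
      unfolding K(1) using K' B_OmegaD(3)[OF U] by (intro borel_in_INT) auto
    obtain v where "v \<in> K" "v \<in> U"
      using K' by blast
    then show "\<not> X \<subseteq> w"
      using is_coverD[OF omega_coverD(1)[OF oc], of v] unfolding K(1) by blast
  next
    fix F assume F: "finite F" "F \<subseteq> X"
    obtain K where "K \<in> subfamilies U n" "\<forall>u\<in>K. F \<subseteq> u"
      using ex_subfamily[OF omega_cover_infinite[OF oc F], of n] by (elim bexE)
    then show "\<exists>w\<in>W n. F \<subseteq> w"
      unfolding W_def by (intro bexI[of _ "\<Inter>K"]) auto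
  qed
  from S1[unfolded S1_def, rule_format, of W, OF W]
  obtain w where w: "\<forall>n. w n \<in> W n" "range w \<in> B_Omega X"
    by (elim exE conjE)
  have "\<exists>K. K \<in> subfamilies U n \<and> w n = \<Inter>K" for n
    using w(1)[rule_format, of n] unfolding W_def by blast
  then obtain K where K: "\<And>n. K n \<in> subfamilies U n" "\<And>n. w n = \<Inter>(K n)"
    by metis
  have "range a \<in> B_Omega X" if a: "\<And>n. a n \<in> K n" for a
  proof (rule B_OmegaI)
    have aU: "a n \<in> U" for n
      using a[of n] K(1)[of n] by (auto simp: subfamilies_def)
    show "countable (range a)"
      by simp
    show "borel_in X u" "\<not> X \<subseteq> u" if "u \<in> range a" for u
      using that aU B_OmegaD(3)[OF U] is_coverD[OF omega_coverD(1)[OF oc]] by auto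
    fix F assume "finite F" "F \<subseteq> X"
    then obtain n where "F \<subseteq> w n"
      using omega_coverD(2)[OF B_OmegaD(2)[OF w(2)], of F] by auto
    then have "F \<subseteq> a n"
      using K(2)[of n] a[of n] by blast
    then show "\<exists>u\<in>range a. F \<subseteq> u"
      by blast
  qed
  then show "\<exists>K. (\<forall>n. K n \<in> subfamilies U n) \<and>
      (\<forall>a. inj a \<and> (\<forall>n. a n \<in> K n) \<longrightarrow> range a \<in> B_Omega X)"
    using K(1) by (intro exI[of _ K]) simp
qed

text \<open>A selection of intersections \<open>B n k\<close> that hits every point infinitely often
  passes to supersets, and injectivity of the choice keeps the infinitely many hits
  distinct.\<close>

lemma (in add_M_continuum) Luzin_Split_B_Lambda:
  assumes X: "\<And>M. meager M \<Longrightarrow> small (X \<inter> M)" and "X \<noteq> {}"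
  shows "Split (B_Lambda X) (B_Lambda X)"
proof (rule Split_if_subfamilies)
  fix U assume "U \<in> B_Lambda X"
  then have U: "countable U" "\<And>u. u \<in> U \<Longrightarrow> borel_in X u" "is_cover X U"
      "\<And>x. x \<in> X \<Longrightarrow> infinite {u\<in>U. x \<in> u}"
    unfolding B_Lambda_def large_cover_def by auto
  obtain h where h: "\<And>u. u \<in> U \<Longrightarrow> cantor_borel (h u) \<and> u = X \<inter> h u"
    using U(2) unfolding borel_in_def by metis
  define G where "G n k = from_nat_into (subfamilies U n) k" for n k
  \<comment> \<open>A point of \<open>X\<close> lies in infinitely many members, which supplies
    subfamilies of every size, so \<open>from_nat_into\<close> really enumerates them.\<close>
  have ne: "subfamilies U n \<noteq> {}" for n
    using ex_subfamily[OF U(4)] \<open>X \<noteq> {}\<close> by blast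
  have G: "G n k \<in> subfamilies U n" for n k
    unfolding G_def by (rule from_nat_into[OF ne])
  define B where "B n k = (\<Inter>u\<in>G n k. h u)" for n k
  have "Baire_property (B n k)" for n k
    unfolding B_def
  proof (intro Baire_property_borel cantor_borel_INT)
    show "finite (G n k)" "G n k \<noteq> {}"
      using G[of n k] subfamily_nonempty unfolding subfamilies_def by auto
    show "cantor_borel (h u)" if "u \<in> G n k" for u
      using G[of n k] that h unfolding subfamilies_def by blast
  qed
  moreover have "\<exists>k. x \<in> B n k" if x: "x \<in> X" for n x
  proof -
    obtain K where K: "K \<in> subfamilies U n" "\<forall>u\<in>K. x \<in> u"
      using ex_subfamily[OF U(4)[OF x]] by blast
    then obtain k where "G n k = K"
      unfolding G_def using from_nat_into_surj[OF countable_subfamilies[OF U(1)]] by blast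
    moreover have "x \<in> h u" if "u \<in> K" for u
      using K that h unfolding subfamilies_def by blast
    ultimately show ?thesis
      unfolding B_def by blast
  qed
  ultimately obtain f where f: "\<And>x. x \<in> X \<Longrightarrow> infinite {n. x \<in> B n (f n)}"
    using Luzin_selection[OF X, of B] by blast
  define K where "K n = G n (f n)" for n
  have K: "K n \<in> subfamilies U n" for n
    unfolding K_def by (rule G)
  have "range a \<in> B_Lambda X" if "inj a" and aK: "\<And>n. a n \<in> K n" for a
  proof -
    have aU: "a n \<in> U" for n
      using aK[of n] K[of n] unfolding subfamilies_def by blast
    have inf: "infinite {u\<in>range a. x \<in> u}" if x: "x \<in> X" for x
    proof -
      have "infinite (a ` {n. x \<in> B n (f n)})"
        using f[OF x] finite_imageD inj_on_subset[OF \<open>inj a\<close>] by blast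
      moreover have "x \<in> a n" if "x \<in> B n (f n)" for n
        using that h[OF aU[of n]] aK[of n] x unfolding B_def K_def by blast
      then have "a ` {n. x \<in> B n (f n)} \<subseteq> {u\<in>range a. x \<in> u}"
        by blast
      ultimately show ?thesis
        using infinite_super by blast
    qed
    have "\<exists>u\<in>range a. x \<in> u" if "x \<in> X" for x
      using infinite_imp_nonempty[OF inf[OF that]] by blast
    then have "is_cover X (range a)"
      using U(3) aU unfolding is_cover_def by blast
    then show ?thesis
      using inf aU U(2) unfolding B_Lambda_def large_cover_def by auto
  qed
  then show "\<exists>K. (\<forall>n. K n \<in> subfamilies U n) \<and>
      (\<forall>a. inj a \<and> (\<forall>n. a n \<in> K n) \<longrightarrow> range a \<in> B_Lambda X)"
    using K by blast
qed

text \<open>Members of the covers are traces of Borel sets of the whole space;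
  \<open>omega_selection\<close> works with these Borel sets, and the traces of the selected ones
  form the cover.\<close>

lemma (in generic_sequence) S1_B_Omega: "S1 (B_Omega (range u)) (B_Omega (range u))"
  unfolding S1_def
proof (intro allI impI)
  fix \<U> :: "nat \<Rightarrow> nat set set set"
  assume "\<forall>n. \<U> n \<in> B_Omega (range u)"
  then have U: "\<U> n \<in> B_Omega (range u)" for n
    by simp
  note ex = omega_coverD(2)[OF B_OmegaD(2)[OF U]]
  have ne: "\<U> n \<noteq> {}" for n
    using ex[of "{}" n] by auto
  define V where "V n k = from_nat_into (\<U> n) k" for n k
  have V: "V n k \<in> \<U> n" for n k
    unfolding V_def by (rule from_nat_into[OF ne])
  have "\<exists>B. cantor_borel B \<and> V n k = range u \<inter> B" for n k
    using B_OmegaD(3)[OF U V] by (simp add: borel_in_def)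
  then obtain B where B: "\<And>n k. cantor_borel (B n k)" "\<And>n k. V n k = range u \<inter> B n k"
    by metis
  have "\<exists>k. F \<subseteq> B n k" if F: "finite F" "F \<subseteq> range u" for n F
  proof -
    obtain v where v: "v \<in> \<U> n" "F \<subseteq> v"
      using ex[OF F, of n] by (elim bexE)
    obtain k where "V n k = v"
      unfolding V_def using from_nat_into_surj[OF B_OmegaD(1)[OF U] v(1)] by (elim exE)
    then have "F \<subseteq> B n k"
      using v(2) B(2)[of n k] by auto
    then show ?thesis ..
  qed
  from omega_selection[of B, OF B(1) this]
  obtain f where f: "\<forall>F. finite F \<and> F \<subseteq> range u \<longrightarrow> (\<exists>n. F \<subseteq> B n (f n))"
    by auto
  have "range (\<lambda>n. V n (f n)) \<in> B_Omega (range u)"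
  proof (rule B_OmegaI)
    show "countable (range (\<lambda>n. V n (f n)))"
      by simp
    fix v assume "v \<in> range (\<lambda>n. V n (f n))"
    then obtain n where "v \<in> \<U> n"
      using V by auto
    then show "borel_in (range u) v" "\<not> range u \<subseteq> v"
      using B_OmegaD(3)[OF U] is_coverD[OF omega_coverD(1)[OF B_OmegaD(2)[OF U]]] by auto
  next
    fix F assume F: "finite F" "F \<subseteq> range u"
    then obtain n where "F \<subseteq> B n (f n)"
      using f by auto
    then have "F \<subseteq> V n (f n)"
      using F(2) B(2) by simp
    then show "\<exists>v\<in>range (\<lambda>n. V n (f n)). F \<subseteq> v"
      by (intro bexI[of _ "V n (f n)"]) auto
  qed
  then show "\<exists>U. (\<forall>n. U n \<in> \<U> n) \<and> range U \<in> B_Omega (range u)"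
    using V by (intro exI[of _ "\<lambda>n. V n (f n)"]) simp
qed

text \<open>For \<open>F \<subseteq> X\<close> the set \<open>u n\<close> contains \<open>F\<close>
  iff \<open>n \<in> \<Inter>F\<close>. A splitting would divide the indices into \<open>I\<close>
  and its complement, but a finite \<open>F\<close> with \<open>\<Inter>F\<close> on one side leaves
  the other part no member containing \<open>F\<close>.\<close>

lemma not_Split_ultrafilter_subbase:
  assumes sfip: "\<And>F. finite F \<Longrightarrow> F \<subseteq> X \<Longrightarrow> infinite (\<Inter>F)"
    and ultra: "\<And>y. \<exists>F. finite F \<and> F \<subseteq> X \<and> (\<Inter>F \<subseteq> y \<or> \<Inter>F \<subseteq> - y)"
  shows "\<not> Split (C_Omega X) (C_Omega X)"
proof
  assume split: "Split (C_Omega X) (C_Omega X)"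
  define u where "u n = {x\<in>X. n \<in> x}" for n
  have clopen: "clopen_in X (u n)" for n
  proof -
    define P where "P = {x. n \<in> x}"
    have mem: "n \<in> B \<longleftrightarrow> n \<in> A" if "B \<in> cyl (Suc n) A" for A B
      using that by (simp add: mem_cyl)
    have op: "cantor_open P"
      unfolding cantor_open_iff P_def using mem by blast
    have cl: "cantor_open (- P)"
      unfolding cantor_open_iff P_def using mem by blast
    have "chi ` (- P) = - chi ` P"
      by (rule bij_image_Compl_eq[OF bij_chi])
    then have "cantor_closed P"
      using cl unfolding cantor_closed_def cantor_open_def by (simp add: closed_def)
    moreover have "u n = X \<inter> P"
      unfolding u_def P_def by blast
    ultimately show ?thesis
      unfolding clopen_in_def using op by auto
  qed
  have ex: "\<exists>n. F \<subseteq> u n" if F: "finite F" "F \<subseteq> X" for F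
  proof -
    have "\<Inter>F \<noteq> {}"
      by (rule infinite_imp_nonempty[OF sfip[OF F]])
    then obtain n where "n \<in> \<Inter>F"
      by blast
    then have "F \<subseteq> u n"
      using F unfolding u_def by blast
    then show ?thesis ..
  qed
  \<comment> \<open>If \<open>n\<close> belonged to every element of \<open>X\<close>, the
    \<open>F\<close> deciding \<open>{n}\<close> would have a finite intersection.\<close>
  have proper: "\<not> X \<subseteq> u n" for n
  proof
    assume X: "X \<subseteq> u n"
    obtain F where F: "finite F" "F \<subseteq> X" "\<Inter>F \<subseteq> {n} \<or> \<Inter>F \<subseteq> - {n}"
      using ultra[of "{n}"] by (elim exE conjE)
    have "n \<in> \<Inter>F"
      using F(2) X unfolding u_def by blast
    then have "\<Inter>F \<subseteq> {n}"
      using F(3) by blast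
    then have "finite (\<Inter>F)"
      by (rule finite_subset) simp
    then show False
      using sfip[OF F(1,2)] by simp
  qed
  have "omega_cover X (range u)"
  proof (rule omega_coverI)
    show "v \<subseteq> X \<and> \<not> X \<subseteq> v" if "v \<in> range u" for v
      using that proper by (auto simp: u_def)
    show "\<exists>v\<in>range u. F \<subseteq> v" if "finite F" "F \<subseteq> X" for F
      using ex[OF that] by auto
  qed
  then have "range u \<in> C_Omega X"
    unfolding C_Omega_def using clopen by auto
  from split[unfolded Split_def, rule_format, OF this]
  obtain V W V' W' where VW: "V \<inter> W = {}" "V' \<subseteq> V" "W' \<subseteq> W" "V \<union> W = range u"
      "V' \<in> C_Omega X" "W' \<in> C_Omega X"
    by auto
  have oc: "omega_cover X V'" "omega_cover X W'"
    using VW(5,6) by (simp_all add: C_Omega_def)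
  define I where "I = {n. u n \<in> V'}"
  obtain F where F: "finite F" "F \<subseteq> X" "\<Inter>F \<subseteq> I \<or> \<Inter>F \<subseteq> - I"
    using ultra[of I] by (elim exE conjE)
  obtain v where v: "v \<in> V'" "F \<subseteq> v"
    using omega_coverD(2)[OF oc(1) F(1,2)] by (elim bexE)
  obtain w where w: "w \<in> W'" "F \<subseteq> w"
    using omega_coverD(2)[OF oc(2) F(1,2)] by (elim bexE)
  have "v \<in> range u" "w \<in> range u"
    using v(1) w(1) VW(2-4) by blast+
  then obtain n m where nm: "v = u n" "w = u m"
    by (elim rangeE)
  have "n \<in> \<Inter>F" "m \<in> \<Inter>F"
    using v(2) w(2) unfolding nm u_def by blast+
  moreover have "n \<in> I"
    using v(1) unfolding I_def nm by simp
  moreover have "m \<notin> I"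
    using w(1) VW(1-3) unfolding I_def nm by blast
  ultimately show False
    using F(3) by blast
qed

section \<open>The two Luzin sets and their union\<close>

theorem theorem6p2:
  assumes "add_M_is (UNIV :: nat set set)"
  shows "\<exists>L0 L1. L0 \<subseteq> inf_subsets \<and> L1 \<subseteq> inf_subsets \<and>
    luzin (UNIV :: nat set set) L0 \<and> luzin (UNIV :: nat set set) L1 \<and>
    S1 (B_Omega L0) (B_Omega L0) \<and> S1 (B_Omega L1) (B_Omega L1) \<and>
    Split (B_Omega L0) (B_Omega L0) \<and> Split (B_Omega L1) (B_Omega L1) \<and>
    Split (B_Lambda L0) (B_Lambda L0) \<and> Split (B_Lambda L1) (B_Lambda L1) \<and>
    Split (B_Lambda (L0 \<union> L1)) (B_Lambda (L0 \<union> L1)) \<and>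
    \<not> Split (C_Omega (L0 \<union> L1)) (C_Omega (L0 \<union> L1))"
proof -
  interpret add_M_continuum
    by unfold_locales (rule assms)
  obtain p where p: "\<And>a. admissible p a (p a)"
    using ex_admissible_function by blast
  define x z where "x = fst \<circ> p" and "z = snd \<circ> p"
  have gen: "generic_at x a (x a)" "generic_at z a (z a)" for a
    using p[of a] unfolding admissible_def x_def z_def by simp_all
  have bas: "(if b then x a else z a) \<in> bas k" if "tag a = to_nat (b, k)" for a b k
    using p[of a] that unfolding admissible_def x_def z_def by (cases b) simp_all
  interpret x: generic_sequence x
  proof
    show "\<exists>t. \<forall>a. tag a = t \<longrightarrow> x a \<in> bas k" for k
      using bas[of _ True k] by (intro exI[of _ "to_nat (True, k)"]) simp
  qed (rule gen)
  interpret z: generic_sequence z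
  proof
    show "\<exists>t. \<forall>a. tag a = t \<longrightarrow> z a \<in> bas k" for k
      using bas[of _ False k] by (intro exI[of _ "to_nat (False, k)"]) simp
  qed (rule gen)
  define L where "L = range x \<union> range z"
  \<comment> \<open>Finitely many indices \<open>G\<close> account for \<open>F\<close>; the
    intersection of \<open>F\<close> contains \<open>meet p G\<close>, which uses both points of
    every index.\<close>
  have sfip: "infinite (\<Inter>F)" if F: "finite F" "F \<subseteq> L" for F
  proof -
    obtain G1 where G1: "finite G1" "F \<inter> range x = x ` G1"
      using finite_subset_image[of "F \<inter> range x" x UNIV] F(1) by auto
    obtain G2 where G2: "finite G2" "F \<inter> range z = z ` G2"
      using finite_subset_image[of "F \<inter> range z" z UNIV] F(1) by auto
    define G where "G = G1 \<union> G2"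
    have "F = (F \<inter> range x) \<union> (F \<inter> range z)"
      using F(2) unfolding L_def by blast
    also have "\<dots> = x ` G1 \<union> z ` G2"
      by (simp only: G1(2) G2(2))
    finally have G: "finite G" "F \<subseteq> x ` G \<union> z ` G"
      using G1(1) G2(1) by (auto simp: G_def)
    have "infinite (meet p G)"
      using infinite_meet[of UNIV p G] p G(1) by blast
    moreover have "meet p G \<subseteq> \<Inter>F"
    proof
      fix i assume "i \<in> meet p G"
      then have "\<forall>g\<in>G. i \<in> x g \<and> i \<in> z g"
        by (simp add: meet_def x_def z_def)
      then show "i \<in> \<Inter>F"
        using G(2) by auto
    qed
    ultimately show ?thesis
      using infinite_super by blast
  qed
  \<comment> \<open>The set \<open>y\<close> is itself an index, and stage \<open>y\<close> decided
    it.\<close>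
  have ultra: "\<exists>F. finite F \<and> F \<subseteq> L \<and> (\<Inter>F \<subseteq> y \<or> \<Inter>F \<subseteq> - y)" for y
  proof (intro exI conjI)
    show "finite {x y, z y}" "{x y, z y} \<subseteq> L"
      by (simp_all add: L_def)
    show "\<Inter>{x y, z y} \<subseteq> y \<or> \<Inter>{x y, z y} \<subseteq> - y"
      using p[of y] by (simp add: admissible_def x_def z_def)
  qed
  have "v \<in> inf_subsets" if "v \<in> L" for v
    using sfip[of "{v}"] that by (simp add: inf_subsets_def)
  then have L_inf: "range x \<subseteq> inf_subsets" "range z \<subseteq> inf_subsets"
    by (auto simp: L_def)
  \<comment> \<open>The union still meets each meager set in a small set, so
    \<open>Luzin_Split_B_Lambda\<close> applies to \<open>L\<close> as well.\<close>
  have "small (L \<inter> M)" if "meager M" for M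
    using small_Un[OF x.small_Int_meager[OF that] z.small_Int_meager[OF that]]
    unfolding L_def Int_Un_distrib2 .
  then have "Split (B_Lambda L) (B_Lambda L)"
    by (intro Luzin_Split_B_Lambda) (auto simp: L_def)
  moreover have "Split (B_Lambda (range x)) (B_Lambda (range x))"
      "Split (B_Lambda (range z)) (B_Lambda (range z))"
    by (intro Luzin_Split_B_Lambda x.small_Int_meager z.small_Int_meager; simp)+
  moreover have "\<not> Split (C_Omega L) (C_Omega L)"
    using not_Split_ultrafilter_subbase[OF sfip ultra] .
  ultimately show ?thesis
    using L_inf
    by (intro exI[of _ "range x"] exI[of _ "range z"] conjI x.luzin_range z.luzin_range
        x.S1_B_Omega z.S1_B_Omega S1_imp_Split_B_Omega) (simp_all add: L_def)
qed

end
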